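(* Let $n\ge 2$, let $K\subseteq\mathbb{R}^n$ be a convex body, and let $\mathcal{F}$ be a family of positive homothets of $K$. Then $$\nu(\mathcal{F})\le\tau(\mathcal{F})\le\frac{\operatorname{vol}(2K-K)}{\operatorname{vol}(K)}\,\bigl(n\log n+n\log\log n+5n\bigr)\,\nu(\mathcal{F}),$$ and moreover $$\frac{\operatorname{vol}(2K-K)}{\operatorname{vol}(K)}\,\bigl(n\log n+n\log\log n+5n\bigr)\,\nu(\mathcal{F})\le\begin{cases}3^n\bigl(n\log n+n\log\log n+5n\bigr)\,\nu(\mathcal{F}) & \text{if } K=-K,\\[2pt] 2^n\binom{2n}{n}\bigl(n\log n+n\log\log n+5n\bigr)\,\nu(\mathcal{F}) & \text{otherwise.}\end{cases}$$
   Context: A convex body in $\mathbb{R}^n$ is a compact convex set with non-empty interior. A positive homothet of a set $S\subseteq\mathbb{R}^n$ is a set of the form $\lambda S+x$ with $\lambda>0$ and $x\in\mathbb{R}^n$. The family $\mathcal{F}$ may be infinite. $\operatorname{vol}$ denotes volume, $\log$ is the natural logarithm, and $2K-K=\{2x-y : x,y\in K\}$ (a Minkowski sum). For a family of sets $\mathcal{F}$, the transversal number is $\tau(\mathcal{F})=\min\{\operatorname{card}(S) : S\cap F\neq\emptyset \text{ for all } F\in\mathcal{F}\}$ (where $S$ ranges over subsets of $\mathbb{R}^n$), and the independence number is $\nu(\mathcal{F})=\max\{\operatorname{card}(S) : S\subseteq\mathcal{F} \text{ and the members of } S \text{ are pairwise disjoint}\}$. Both are regarded as elements of $\{0,1,2,\dots\}\cup\{\infty\}$: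 $\tau(\mathcal{F})=\infty$ if there is no finite transversal, and $\nu(\mathcal{F})=\infty$ if the sizes of pairwise disjoint subfamilies are unbounded. *)

theory Defs
  imports "HOL-Analysis.Analysis"
begin

definition convex_body :: "'a::euclidean_space set \<Rightarrow> bool" where
  "convex_body K \<longleftrightarrow> compact K \<and> convex K \<and> interior K \<noteq> {}"

definition positive_homothet :: "'a::real_vector set \<Rightarrow> 'a set \<Rightarrow> bool" where
  "positive_homothet S T \<longleftrightarrow> (\<exists>r::real. \<exists>x. r > 0 \<and> T = (\<lambda>y. r *\<^sub>R y + x) ` S)"

text \<open>The library's \<open>card\<close> is 0 on infinite sets, hence the following variant.\<close>

definition ecard :: "'a set \<Rightarrow> enat" where
  "ecard S = (if finite S then enat (card S) else \<infinity>)"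

text \<open>In \<open>enat\<close>, an infimum over a nonempty set is attained, and a supremum is either attained
  or \<open>\<infinity>\<close>; so these are the minimum and maximum, with value \<open>\<infinity>\<close> in the
  cases where no finite one exists.\<close>

definition transversal_number :: "'a set set \<Rightarrow> enat" (\<open>\<tau>\<close>) where
  "\<tau> \<F> = (INF S \<in> {S. \<forall>F\<in>\<F>. S \<inter> F \<noteq> {}}. ecard S)"

definition independence_number :: "'a set set \<Rightarrow> enat" (\<open>\<nu>\<close>) where
  "\<nu> \<F> = (SUP S \<in> {S. S \<subseteq> \<F> \<and> pairwise disjnt S}. ecard S)"

abbreviation vol :: "'a::euclidean_space set \<Rightarrow> real" where
  "vol \<equiv> measure lebesgue"

definition two_minus :: "'a::real_vector set \<Rightarrow> 'a set" where
  "two_minus K = {2 *\<^sub>R x - y | x y. x \<in> K \<and> y \<in> K}"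

end

theory Submission
  imports Defs
begin

text \<open>
  A greedy choice reduces the upper bound to covering a convex body by translates of another.
  Take a smallest member \<open>r K + x\<close> of a finite family. A member meeting it in a point \<open>q\<close> is at
  least as large, so shrinking it towards \<open>q\<close> produces a translate of \<open>r K\<close> that it contains and
  that still meets \<open>r K + x\<close>. The translates of \<open>K\<close> meeting \<open>K\<close> are the \<open>K + a\<close> with
  \<open>a \<in> K - K\<close>, and a point \<open>p\<close> lies in \<open>K + a\<close> if and only if \<open>a \<in> p - K\<close>. Hence if \<open>N\<close>
  translates of \<open>- K\<close> cover \<open>K - K\<close>, then \<open>N\<close> points pierce all members meeting the smallest
  one. The remaining members are disjoint from it, so their independence number is smaller by at
  least one, and induction gives at most \<open>N \<nu>\<close> points
  (\<open>pierceable_finite_greedy\<close>, \<open>pierceable_meeting_smallest_homothet\<close>).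

  An infinite family need not have a smallest member, since the homothety factors may approach
  an unattained infimum, possibly \<open>0\<close>. But the members are compact, and for compact sets
  piercing by \<open>k\<close> points is determined by the finite subfamilies (\<open>pierceable_compactness\<close>).

  It remains to show \<open>N \<le> q c\<close> with \<open>q = vol (2K - K) / vol K\<close>; here
  \<open>c = n ln n + n ln (ln n) + 5 n\<close>, and
  \<open>(K - K) - (- K) = 2K - K\<close>. To cover a compact set \<open>A\<close> by translates of a convex body \<open>B\<close>,
  choose a finite net \<open>L\<close> in \<open>A\<close> at scale \<open>\<eta>\<close> and cover only \<open>L\<close>, by translates of the
  slightly smaller body \<open>(1 - \<eta>) B\<close>; passing from \<open>(1 - \<eta>) B\<close> to \<open>B\<close> then covers \<open>A\<close>. By
  averaging, some translate of \<open>(1 - \<eta>) B\<close> covers at least the fraction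
  \<open>r = (1 - \<eta>)^n vol B / vol (A - B)\<close> of any given subset of \<open>L\<close>. Greedily choosing such
  translates leaves a \<open>(1 - r)^m\<close> fraction of \<open>L\<close> after \<open>m\<close> steps, so about
  \<open>(ln (r card L) + 1) / r\<close> translates suffice. A volume comparison bounds \<open>card L\<close>, with
  only an exponential factor lost to the asymmetry of \<open>B\<close> because some centrally symmetric part
  of \<open>B\<close> has volume at least \<open>2^(-n) vol B\<close>. The result is \<open>covering_number_bound\<close>; letting
  \<open>\<eta>\<close> be of order \<open>1 / (n ln n)\<close> yields the constant \<open>c\<close>
  (\<open>covering_constant_arithmetic\<close>).

  Finally \<open>2K - K = 3K\<close> for symmetric \<open>K\<close>, while in general \<open>2K - K\<close> lies in a translate of
  \<open>2 (K - K)\<close>, whose volume is controlled by the Rogers--Shephard inequality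
  (\<open>rogers_shephard\<close>).
\<close>

section \<open>Piercing families of homothets\<close>

definition pierceable :: "nat \<Rightarrow> 'a set set \<Rightarrow> bool" where
  "pierceable k \<F> \<longleftrightarrow> (\<exists>P. finite P \<and> card P \<le> k \<and> (\<forall>F\<in>\<F>. P \<inter> F \<noteq> {}))"

text \<open>
  By induction on \<open>k\<close>. A fixed member \<open>F0\<close> has to contain one of the piercing points, and it
  suffices to find \<open>p \<in> F0\<close> such that the finite families of members missing \<open>p\<close> are all
  \<open>k\<close>-pierceable. If every \<open>p\<close> had a finite counterexample \<open>G p\<close>, then, the members being
  closed, \<open>G p\<close> would still miss all points of a neighbourhood of \<open>p\<close>; finitely many such
  neighbourhoods cover \<open>F0\<close>, and \<open>F0\<close> together with the corresponding \<open>G p\<close> is a finite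
  subfamily that \<open>k + 1\<close> points cannot pierce, as one of them would lie in \<open>F0\<close>
  and miss all members of some \<open>G p\<close>, leaving only \<open>k\<close> points to pierce these.
\<close>

lemma pierceable_compactness:
  fixes \<F> :: "'a::t2_space set set"
  assumes "\<And>F. F \<in> \<F> \<Longrightarrow> compact F"
    and "\<And>\<G>. finite \<G> \<Longrightarrow> \<G> \<subseteq> \<F> \<Longrightarrow> pierceable k \<G>"
  shows "pierceable k \<F>"
  using assms
proof (induction k arbitrary: \<F>)
  case 0
  have "\<F> = {}"
  proof (rule ccontr)
    assume "\<F> \<noteq> {}"
    then obtain F where "F \<in> \<F>" by blast
    then have "pierceable 0 {F}" using 0(2)[of "{F}"] by simp
    then show False by (auto simp: pierceable_def)
  qed
  then show ?case by (auto simp: pierceable_def intro!: exI[of _ "{}"])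
next
  case (Suc k)
  show ?case
  proof (cases "\<F> = {}")
    case True
    then show ?thesis by (auto simp: pierceable_def intro!: exI[of _ "{}"])
  next
    case False
    then obtain F0 where F0: "F0 \<in> \<F>" by blast
    have "\<exists>p. \<forall>\<G>. finite \<G> \<longrightarrow> \<G> \<subseteq> {F \<in> \<F>. p \<notin> F} \<longrightarrow> pierceable k \<G>"
    proof (rule ccontr)
      assume "\<not> ?thesis"
      then have "\<forall>p. \<exists>\<G>. finite \<G> \<and> \<G> \<subseteq> {F \<in> \<F>. p \<notin> F} \<and> \<not> pierceable k \<G>"
        by blast
      then obtain G where G: "\<And>p. finite (G p)" "\<And>p. G p \<subseteq> {F \<in> \<F>. p \<notin> F}"
          "\<And>p. \<not> pierceable k (G p)"
        by metis
      have "open (- \<Union>(G p))" for p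
    proof (intro open_Compl closed_Union ballI)
        show "closed F" if "F \<in> G p" for F
          using that G(2)[of p] Suc.prems(1) by (auto intro: compact_imp_closed)
      qed (rule G(1))
      moreover have "F0 \<subseteq> (\<Union>p\<in>F0. - \<Union>(G p))"
        using G(2) by blast
      ultimately obtain C where C: "C \<subseteq> F0" "finite C" "F0 \<subseteq> (\<Union>p\<in>C. - \<Union>(G p))"
        by (rule compactE_image[OF Suc.prems(1)[OF F0], of F0 "\<lambda>p. - \<Union>(G p)"]) auto
      have "pierceable (Suc k) (insert F0 (\<Union>p\<in>C. G p))"
        using G(1,2) C(2) F0 by (intro Suc.prems(2)) auto
      then obtain P where P: "finite P" "card P \<le> Suc k"
          "\<And>F. F \<in> insert F0 (\<Union>p\<in>C. G p) \<Longrightarrow> P \<inter> F \<noteq> {}"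
        by (auto simp: pierceable_def)
      obtain q where q: "q \<in> P" "q \<in> F0" using P(3)[of F0] by auto
      then obtain p where p: "p \<in> C" "q \<notin> \<Union>(G p)" using C(3) by blast
      have "(P - {q}) \<inter> F \<noteq> {}" if "F \<in> G p" for F
        using P(3)[of F] that p by blast
      moreover have "card (P - {q}) \<le> k" using P(1,2) q(1) by simp
      ultimately have "pierceable k (G p)"
        using P(1) by (auto simp: pierceable_def intro!: exI[of _ "P - {q}"])
      with G(3) show False by blast
    qed
    then obtain p where p: "\<And>\<G>. finite \<G> \<Longrightarrow> \<G> \<subseteq> {F \<in> \<F>. p \<notin> F} \<Longrightarrow> pierceable k \<G>"
      by blast
    have "pierceable k {F \<in> \<F>. p \<notin> F}"
      by (rule Suc.IH) (use Suc.prems(1) p in auto)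
    then obtain P where P: "finite P" "card P \<le> k" "\<And>F. F \<in> \<F> \<Longrightarrow> p \<notin> F \<Longrightarrow> P \<inter> F \<noteq> {}"
      by (auto simp: pierceable_def)
    then show ?thesis
      unfolding pierceable_def
      by (intro exI[of _ "insert p P"]) (auto intro: card_insert_le_m1 simp: card_insert_if)
  qed
qed

text \<open>
  The members disjoint from \<open>F0\<close> have a smaller independence number, because \<open>F0\<close> can be added
  to any disjoint subfamily of them. The assumption is about all subfamilies since the choice of
  \<open>F0\<close> is repeated in what is left over.
\<close>

lemma pierceable_finite_greedy:
  assumes "finite \<F>"
    and "\<And>F. F \<in> \<F> \<Longrightarrow> F \<noteq> {}"
    and step: "\<And>\<G>. \<G> \<subseteq> \<F> \<Longrightarrow> \<G> \<noteq> {} \<Longrightarrow> \<exists>F0\<in>\<G>. pierceable N {F \<in> \<G>. \<not> disjnt F F0}"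
    and "\<And>\<S>. \<S> \<subseteq> \<F> \<Longrightarrow> pairwise disjnt \<S> \<Longrightarrow> card \<S> \<le> k"
  shows "pierceable (N * k) \<F>"
  using assms
proof (induction k arbitrary: \<F>)
  case 0
  have "\<F> = {}"
  proof (rule ccontr)
    assume "\<F> \<noteq> {}"
    then obtain F where "F \<in> \<F>" by blast
    then show False using 0(4)[of "{F}"] by simp
  qed
  then show ?case by (auto simp: pierceable_def intro!: exI[of _ "{}"])
next
  case (Suc k)
  show ?case
  proof (cases "\<F> = {}")
    case True
    then show ?thesis by (auto simp: pierceable_def intro!: exI[of _ "{}"])
  next
    case False
    then obtain F0 where F0: "F0 \<in> \<F>" "pierceable N {F \<in> \<F>. \<not> disjnt F F0}"
      using Suc.prems(3) by blast
    obtain P where P: "finite P" "card P \<le> N"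
        "\<And>F. F \<in> \<F> \<Longrightarrow> \<not> disjnt F F0 \<Longrightarrow> P \<inter> F \<noteq> {}"
      using F0(2) by (auto simp: pierceable_def)
    have "pierceable (N * k) {F \<in> \<F>. disjnt F F0}"
    proof (rule Suc.IH)
      show "card \<S> \<le> k" if "\<S> \<subseteq> {F \<in> \<F>. disjnt F F0}" "pairwise disjnt \<S>" for \<S>
      proof -
        have "F0 \<notin> \<S>" using that(1) F0(1) Suc.prems(2) by auto
        moreover have "finite \<S>" using that(1) Suc.prems(1) by (auto intro: finite_subset)
        moreover have "pairwise disjnt (insert F0 \<S>)"
          using that by (auto simp: pairwise_insert disjnt_sym)
        then have "card (insert F0 \<S>) \<le> Suc k"
          using that F0(1) by (intro Suc.prems(4)) auto
        ultimately show ?thesis by simp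
      qed
    next
      fix \<G> assume "\<G> \<subseteq> {F \<in> \<F>. disjnt F F0}" "\<G> \<noteq> {}"
      then show "\<exists>F0\<in>\<G>. pierceable N {F \<in> \<G>. \<not> disjnt F F0}"
        using Suc.prems(3)[of \<G>] by blast
    qed (use Suc.prems in auto)
    then obtain Q where Q: "finite Q" "card Q \<le> N * k"
        "\<And>F. F \<in> \<F> \<Longrightarrow> disjnt F F0 \<Longrightarrow> Q \<inter> F \<noteq> {}"
      by (auto simp: pierceable_def)
    have "card (P \<union> Q) \<le> N * Suc k"
      using card_Un_le[of P Q] P(2) Q(2) by simp
    moreover have "(P \<union> Q) \<inter> F \<noteq> {}" if "F \<in> \<F>" for F
      using P(3)[OF that] Q(3)[OF that] by blast
    ultimately show ?thesis
      using P(1) Q(1) by (auto simp: pierceable_def intro!: exI[of _ "P \<union> Q"])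
  qed
qed

text \<open>
  Contract the larger homothet towards \<open>p\<close> by the ratio \<open>r / s\<close>; by convexity the image stays inside.
\<close>

lemma homothet_shrink:
  fixes K :: "'a::real_vector set"
  assumes "convex K" "0 < r" "r \<le> s" "p \<in> (\<lambda>y. s *\<^sub>R y + x) ` K"
  shows "\<exists>x'. p \<in> (\<lambda>y. r *\<^sub>R y + x') ` K \<and> (\<lambda>y. r *\<^sub>R y + x') ` K \<subseteq> (\<lambda>y. s *\<^sub>R y + x) ` K"
proof -
  obtain k where k: "k \<in> K" "p = s *\<^sub>R k + x" using assms(4) by auto
  define x' where "x' = p - r *\<^sub>R k"
  have "p \<in> (\<lambda>y. r *\<^sub>R y + x') ` K"
    using k(1) by (intro image_eqI[of _ _ k]) (auto simp: x'_def)
  moreover have "r *\<^sub>R y + x' \<in> (\<lambda>y. s *\<^sub>R y + x) ` K" if "y \<in> K" for y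
  proof (rule image_eqI)
    show "(r / s) *\<^sub>R y + (1 - r / s) *\<^sub>R k \<in> K"
      using assms that k(1) by (intro convexD) auto
    show "r *\<^sub>R y + x' = s *\<^sub>R ((r / s) *\<^sub>R y + (1 - r / s) *\<^sub>R k) + x"
      using assms(2,3) by (simp add: x'_def k(2) algebra_simps)
  qed
  ultimately show ?thesis by auto
qed

text \<open>
  The assumption on \<open>P\<close> says that \<open>P\<close> meets every translate \<open>K + (x - y)\<close> that meets \<open>K\<close>;
  the homothety taking \<open>K\<close> to \<open>F0\<close> transports \<open>P\<close> to a set piercing the translates of \<open>F0\<close> that
  meet \<open>F0\<close>, and every larger homothet that meets \<open>F0\<close> contains such a translate.
\<close>

lemma pierceable_meeting_smallest_homothet:
  fixes K :: "'a::real_vector set"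
  assumes "convex K"
    and P: "finite P" "card P \<le> N" "\<And>x y. x \<in> K \<Longrightarrow> y \<in> K \<Longrightarrow> \<exists>p\<in>P. p - (x - y) \<in> K"
    and F0: "F0 = (\<lambda>y. r *\<^sub>R y + x0) ` K" "0 < r"
    and F: "\<And>F. F \<in> \<F> \<Longrightarrow> \<exists>s x. r \<le> s \<and> F = (\<lambda>y. s *\<^sub>R y + x) ` K"
  shows "pierceable N {F \<in> \<F>. \<not> disjnt F F0}"
proof -
  have "(\<lambda>y. r *\<^sub>R y + x0) ` P \<inter> F \<noteq> {}" if FF: "F \<in> \<F>" "\<not> disjnt F F0" for F
  proof -
    obtain s x where sx: "r \<le> s" "F = (\<lambda>y. s *\<^sub>R y + x) ` K" using F[OF FF(1)] by blast
    obtain q where q: "q \<in> F" "q \<in> F0" using FF(2) by (auto simp: disjnt_def)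
    obtain x' where x': "q \<in> (\<lambda>y. r *\<^sub>R y + x') ` K" "(\<lambda>y. r *\<^sub>R y + x') ` K \<subseteq> F"
      using homothet_shrink[OF assms(1) F0(2) sx(1), of q x] q(1) sx(2) by auto
    obtain a b where ab: "a \<in> K" "b \<in> K" "r *\<^sub>R a + x0 = r *\<^sub>R b + x'"
      using q(2) x'(1) F0(1) by auto
    obtain p where p: "p \<in> P" "p - (a - b) \<in> K" using P(3)[OF ab(1,2)] by blast
    have "x' = r *\<^sub>R a - r *\<^sub>R b + x0"
      using ab(3) by (simp add: algebra_simps)
    then have "r *\<^sub>R p + x0 = r *\<^sub>R (p - (a - b)) + x'"
      by (simp add: algebra_simps)
    then have "r *\<^sub>R p + x0 \<in> F" using x'(2) p(2) by auto
    then show ?thesis using p(1) by blast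
  qed
  moreover have "card ((\<lambda>y. r *\<^sub>R y + x0) ` P) \<le> N"
    using card_image_le[OF P(1), of "\<lambda>y. r *\<^sub>R y + x0"] P(2) by simp
  ultimately show ?thesis
    using P(1) by (auto simp: pierceable_def intro!: exI[of _ "(\<lambda>y. r *\<^sub>R y + x0) ` P"])
qed

lemma pierceable_homothets:
  fixes K :: "'a::real_normed_vector set"
  assumes "compact K" "convex K" "K \<noteq> {}"
    and P: "finite P" "\<And>x y. x \<in> K \<Longrightarrow> y \<in> K \<Longrightarrow> \<exists>p\<in>P. p - (x - y) \<in> K"
    and hom: "\<And>F. F \<in> \<F> \<Longrightarrow> positive_homothet K F"
    and k: "\<And>\<S>. finite \<S> \<Longrightarrow> \<S> \<subseteq> \<F> \<Longrightarrow> pairwise disjnt \<S> \<Longrightarrow> card \<S> \<le> k"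
  shows "pierceable (card P * k) \<F>"
proof (rule pierceable_compactness)
  show "compact F" if "F \<in> \<F>" for F
  proof -
    have "positive_homothet K F" using that by (rule hom)
    then obtain r x where "F = (\<lambda>y. r *\<^sub>R y + x) ` K"
      by (auto simp: positive_homothet_def)
    then show ?thesis
      using assms(1) by (auto intro!: compact_continuous_image continuous_intros)
  qed
  fix \<G> assume G: "finite \<G>" "\<G> \<subseteq> \<F>"
  have "\<forall>F\<in>\<G>. \<exists>r x. r > 0 \<and> F = (\<lambda>y. r *\<^sub>R y + x) ` K"
    using hom G(2) by (auto simp: positive_homothet_def)
  then obtain r x where rx: "\<And>F. F \<in> \<G> \<Longrightarrow> r F > 0 \<and> F = (\<lambda>y. r F *\<^sub>R y + x F) ` K"
    by metis
  show "pierceable (card P * k) \<G>"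
  proof (rule pierceable_finite_greedy)
    show "F \<noteq> {}" if "F \<in> \<G>" for F
      using rx[OF that] assms(3) by (metis image_is_empty)
    show "\<exists>F0\<in>\<H>. pierceable (card P) {F \<in> \<H>. \<not> disjnt F F0}" if H: "\<H> \<subseteq> \<G>" "\<H> \<noteq> {}" for \<H>
    proof -
      have fin: "finite \<H>" using G(1) H(1) by (rule rev_finite_subset)
      define F0 where "F0 = arg_min_on r \<H>"
      have F0: "F0 \<in> \<H>" "\<And>F. F \<in> \<H> \<Longrightarrow> r F0 \<le> r F"
        using arg_min_if_finite(1)[OF fin H(2), of r] arg_min_least[OF fin H(2), of _ r]
        by (auto simp: F0_def)
      have "pierceable (card P) {F \<in> \<H>. \<not> disjnt F F0}"
      proof (rule pierceable_meeting_smallest_homothet[OF assms(2) P(1) _ P(2)])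
        show "F0 = (\<lambda>y. r F0 *\<^sub>R y + x F0) ` K" "0 < r F0"
          using rx F0(1) H(1) by blast+
        show "\<exists>s x. r F0 \<le> s \<and> F = (\<lambda>y. s *\<^sub>R y + x) ` K" if "F \<in> \<H>" for F
          using rx[of F] F0(2)[OF that] that H(1) by blast
      qed auto
      with F0(1) show ?thesis by blast
    qed
    show "card \<S> \<le> k" if "\<S> \<subseteq> \<G>" "pairwise disjnt \<S>" for \<S>
      using k[of \<S>] that G by (auto intro: finite_subset)
  qed (use G in auto)
qed

lemma independence_number_le_transversal_number: "\<nu> \<F> \<le> \<tau> \<F>"
  unfolding independence_number_def transversal_number_def
proof (intro SUP_least INF_greatest)
  fix \<S> T assume "\<S> \<in> {S. S \<subseteq> \<F> \<and> pairwise disjnt S}" "T \<in> {S. \<forall>F\<in>\<F>. S \<inter> F \<noteq> {}}"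
  then have S: "\<S> \<subseteq> \<F>" "pairwise disjnt \<S>" and T: "\<And>F. F \<in> \<F> \<Longrightarrow> \<exists>t. t \<in> T \<inter> F"
    by auto
  obtain t where t: "\<And>F. F \<in> \<F> \<Longrightarrow> t F \<in> T \<inter> F" using T by metis
  have inj: "inj_on t \<S>"
  proof (rule inj_onI, rule ccontr)
    fix F G assume FG: "F \<in> \<S>" "G \<in> \<S>" "t F = t G" "F \<noteq> G"
    then have "disjnt F G" using S(2) by (auto simp: pairwise_def)
    moreover have "t F \<in> F" "t F \<in> G" using t[of F] t[of G] FG S(1) by auto
    ultimately show False by (auto simp: disjnt_def)
  qed
  have sub: "t ` \<S> \<subseteq> T" using t S(1) by auto
  show "ecard \<S> \<le> ecard T"
    using card_inj_on_le[OF inj sub] inj_on_finite[OF inj sub] by (auto simp: ecard_def)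
qed

lemma transversal_number_le_if_pierceable:
  assumes "pierceable k \<F>"
  shows "\<tau> \<F> \<le> enat k"
proof -
  obtain P where P: "finite P" "card P \<le> k" "\<forall>F\<in>\<F>. P \<inter> F \<noteq> {}"
    using assms by (auto simp: pierceable_def)
  then have "\<tau> \<F> \<le> ecard P"
    unfolding transversal_number_def by (intro INF_lower) auto
  also have "\<dots> \<le> enat k" using P by (simp add: ecard_def)
  finally show ?thesis .
qed

lemma card_le_independence_number:
  assumes "finite \<S>" "\<S> \<subseteq> \<F>" "pairwise disjnt \<S>"
  shows "enat (card \<S>) \<le> \<nu> \<F>"
proof -
  have "ecard \<S> \<le> \<nu> \<F>"
    unfolding independence_number_def using assms by (intro SUP_upper) auto
  then show ?thesis using assms(1) by (simp add: ecard_def)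
qed

text \<open>
  Positivity of \<open>C\<close> is what makes the right-hand side infinite when the independence number is.
\<close>

lemma transversal_number_homothets_le:
  fixes K :: "'a::real_normed_vector set"
  assumes "compact K" "convex K" "K \<noteq> {}"
    and P: "finite P" "\<And>x y. x \<in> K \<Longrightarrow> y \<in> K \<Longrightarrow> \<exists>p\<in>P. p - (x - y) \<in> K"
    and hom: "\<And>F. F \<in> \<F> \<Longrightarrow> positive_homothet K F"
    and C: "real (card P) \<le> C" "0 < C"
  shows "ereal_of_enat (\<tau> \<F>) \<le> ereal C * ereal_of_enat (\<nu> \<F>)"
proof (cases "\<nu> \<F>")
  case (enat k)
  have "pierceable (card P * k) \<F>"
  proof (rule pierceable_homothets[OF assms(1-6)])
    show "card \<S> \<le> k" if "finite \<S>" "\<S> \<subseteq> \<F>" "pairwise disjnt \<S>" for \<S>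
      using card_le_independence_number[OF that] enat by simp
  qed
  then have "ereal_of_enat (\<tau> \<F>) \<le> ereal_of_enat (enat (card P * k))"
    using transversal_number_le_if_pierceable by (simp only: ereal_of_enat_le_iff)
  also have "\<dots> = ereal (real (card P) * real k)" by simp
  also have "\<dots> \<le> ereal (C * real k)"
    using C(1) by (simp only: ereal_less_eq) (rule mult_right_mono, auto)
  finally show ?thesis by (simp add: enat)
next
  case infinity
  then show ?thesis using C(2) by simp
qed

section \<open>Volume, translates and averages\<close>

lemma mem_reflect_iff: "z \<in> (\<lambda>x. d - x) ` B \<longleftrightarrow> d - z \<in> B" for z :: "'a::ab_group_add"
  by (auto simp: image_iff intro!: bexI[of _ "d - z"])

lemma mem_translate_iff: "z \<in> (+) d ` B \<longleftrightarrow> z - d \<in> B" for z :: "'a::ab_group_add"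
  by (auto simp: image_iff intro!: bexI[of _ "z - d"])

lemma emeasure_lborel_compact:
  fixes S :: "'a::euclidean_space set"
  assumes "compact S"
  shows "emeasure lborel S = ennreal (vol S)"
proof -
  have "measure lebesgue S = measure lborel S"
    using assms by (simp add: measure_completion compact_imp_closed)
  then show ?thesis
    using emeasure_compact_finite[OF assms] by (simp add: emeasure_eq_ennreal_measure)
qed

lemma vol_affine_image:
  fixes S :: "'a::euclidean_space set"
  shows "vol ((\<lambda>x. m *\<^sub>R x + d) ` S) = \<bar>m\<bar> ^ DIM('a) * vol S"
  by (rule measure_lebesgue_affine)

lemma vol_reflect:
  fixes S :: "'a::euclidean_space set"
  shows "vol ((\<lambda>x. d - x) ` S) = vol S"
  using vol_affine_image[of "-1" d S] by simp

lemma vol_scaleR_image: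
  fixes S :: "'a::euclidean_space set"
  shows "vol ((*\<^sub>R) m ` S) = \<bar>m\<bar> ^ DIM('a) * vol S"
  using vol_affine_image[of m 0 S] by simp

lemma vol_mono_compact:
  fixes S T :: "'a::euclidean_space set"
  assumes "compact S" "compact T" "S \<subseteq> T"
  shows "vol S \<le> vol T"
  using assms by (intro measure_mono_fmeasurable) (auto intro: lmeasurable_compact fmeasurableD)

lemma convex_body_vol_pos:
  assumes "convex_body K"
  shows "vol K > 0"
proof -
  have "\<not> negligible K"
    using assms negligible_convex_interior by (auto simp: convex_body_def)
  moreover have "K \<in> lmeasurable"
    using assms by (auto simp: convex_body_def intro: lmeasurable_compact)
  ultimately show ?thesis
    by (simp add: negligible_iff_measure order_less_le)
qed

lemma exists_ge_average:
  assumes Z: "Z \<in> sets M" and pos: "emeasure M Z \<noteq> 0" and fin: "emeasure M Z < \<infinity>"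
    and f: "f \<in> borel_measurable M"
    and c: "c < \<infinity>" and avg: "c * emeasure M Z \<le> (\<integral>\<^sup>+z. f z * indicator Z z \<partial>M)"
  shows "\<exists>z\<in>Z. c \<le> f z"
proof (rule ccontr)
  assume "\<not> ?thesis"
  then have less: "f z < c" if "z \<in> Z" for z
    using that by (auto simp: not_le)
  have cZ: "(\<integral>\<^sup>+z. c * indicator Z z \<partial>M) = c * emeasure M Z"
    using Z by (simp add: nn_integral_cmult_indicator)
  have le: "f z * indicator Z z \<le> c * indicator Z z" for z
    using less[of z] by (auto simp: indicator_def less_imp_le)
  have "(\<integral>\<^sup>+z. f z * indicator Z z \<partial>M) < (\<integral>\<^sup>+z. c * indicator Z z \<partial>M)"
  proof (rule nn_integral_less)
    have "(\<integral>\<^sup>+z. f z * indicator Z z \<partial>M) \<le> c * emeasure M Z"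
      unfolding cZ[symmetric] by (intro nn_integral_mono le)
    also have "\<dots> < \<infinity>"
      using c fin by (simp add: ennreal_mult_less_top)
    finally show "(\<integral>\<^sup>+z. f z * indicator Z z \<partial>M) \<noteq> \<infinity>" by simp
    show "\<not> (AE z in M. c * indicator Z z \<le> f z * indicator Z z)"
    proof
      assume "AE z in M. c * indicator Z z \<le> f z * indicator Z z"
      then have "AE z in M. z \<notin> Z"
      proof (rule AE_mp, intro AE_I2 impI)
        fix z assume "c * indicator Z z \<le> f z * (indicator Z z :: ennreal)"
        then show "z \<notin> Z"
          using less[of z] by (auto simp: indicator_def not_le)
      qed
      then have "emeasure M Z = 0"
        using Z by (auto simp flip: AE_iff_null_sets)
      with pos show False by simp
    qed
  qed (use Z f le in auto)
  with avg cZ show False by simp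
qed

text \<open>
  Fubini's theorem for \<open>(y, z) \<mapsto> indicator B y * indicator C (y - z)\<close>; this integral is what both the
  symmetrization below and the Rogers--Shephard inequality compare with.
\<close>

lemma
  fixes B C :: "'a::euclidean_space set"
  assumes B: "compact B" and C: "compact C"
  shows nn_integral_emeasure_Int_translate:
      "(\<integral>\<^sup>+z. emeasure lborel (B \<inter> (+) z ` C) \<partial>lborel) = ennreal (vol B * vol C)"
    and borel_measurable_emeasure_Int_translate:
      "(\<lambda>z. emeasure lborel (B \<inter> (+) z ` C)) \<in> borel_measurable borel"
proof -
  have [measurable]: "B \<in> sets borel" "C \<in> sets borel"
    using B C by (auto intro: borel_compact)
  have eq: "emeasure lborel (B \<inter> (+) z ` C)
    = (\<integral>\<^sup>+y. indicator B y * indicator C (y - z) \<partial>lborel)" for z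
  proof -
    have "compact ((+) z ` C)" using C by (rule compact_translation)
    then have "B \<inter> (+) z ` C \<in> sets lborel"
      using B by (auto intro!: borel_compact compact_Int)
    then have "emeasure lborel (B \<inter> (+) z ` C) = (\<integral>\<^sup>+y. indicator (B \<inter> (+) z ` C) y \<partial>lborel)"
      by simp
    also have "\<dots> = (\<integral>\<^sup>+y. indicator B y * indicator C (y - z) \<partial>lborel)"
      by (intro nn_integral_cong) (simp add: indicator_def mem_translate_iff)
    finally show ?thesis .
  qed
  show "(\<lambda>z. emeasure lborel (B \<inter> (+) z ` C)) \<in> borel_measurable borel"
    unfolding eq by measurable
  have refl: "(\<integral>\<^sup>+z. indicator C (y - z) \<partial>lborel) = ennreal (vol C)" for y
  proof -
    have cp: "compact ((\<lambda>x. y - x) ` C)"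
      using C by (intro compact_continuous_image continuous_intros)
    have "(\<integral>\<^sup>+z. indicator C (y - z) \<partial>lborel) = (\<integral>\<^sup>+z. indicator ((\<lambda>x. y - x) ` C) z \<partial>lborel)"
      by (intro nn_integral_cong) (simp add: indicator_def mem_reflect_iff)
    also have "\<dots> = emeasure lborel ((\<lambda>x. y - x) ` C)"
      using cp by (simp add: borel_compact)
    also have "\<dots> = ennreal (vol C)"
      using cp by (simp add: emeasure_lborel_compact vol_reflect)
    finally show ?thesis .
  qed
  have "(\<integral>\<^sup>+z. emeasure lborel (B \<inter> (+) z ` C) \<partial>lborel)
    = (\<integral>\<^sup>+z. \<integral>\<^sup>+y. indicator B y * indicator C (y - z) \<partial>lborel \<partial>lborel)"
    by (simp add: eq)
  also have "\<dots> = (\<integral>\<^sup>+y. \<integral>\<^sup>+z. indicator B y * indicator C (y - z) \<partial>lborel \<partial>lborel)"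
    by (rule lborel_pair.Fubini') measurable
  also have "\<dots> = (\<integral>\<^sup>+y. ennreal (vol C) * indicator B y \<partial>lborel)"
    by (simp add: nn_integral_cmult refl mult.commute)
  also have "\<dots> = ennreal (vol C) * ennreal (vol B)"
    using B by (simp add: nn_integral_cmult_indicator emeasure_lborel_compact)
  also have "\<dots> = ennreal (vol B * vol C)"
    by (simp add: ennreal_mult' mult.commute)
  finally show "(\<integral>\<^sup>+z. emeasure lborel (B \<inter> (+) z ` C) \<partial>lborel) = ennreal (vol B * vol C)" .
qed

text \<open>
  The sets \<open>B \<inter> (z - B)\<close> are empty unless \<open>z \<in> 2B\<close>, and their volumes integrate to
  \<open>(vol B)^2\<close> over \<open>z\<close>. As \<open>vol (2B) = 2^n vol B\<close>, the average over \<open>2B\<close> is \<open>vol B / 2^n\<close>.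
\<close>

lemma exists_large_symmetric_part:
  fixes B :: "'a::euclidean_space set"
  assumes "compact B" "convex B" "vol B > 0"
  shows "\<exists>c. vol B / 2 ^ DIM('a) \<le> vol (B \<inter> (\<lambda>x. 2 *\<^sub>R c - x) ` B)"
proof -
  define Z where "Z = (*\<^sub>R) 2 ` B"
  define f where "f z = emeasure lborel (B \<inter> (+) z ` uminus ` B)" for z
  have cZ: "compact Z" unfolding Z_def using assms(1) by (rule compact_scaling)
  have cm: "compact (uminus ` B)" using assms(1) by (rule compact_negations)
  have vZ: "vol Z = 2 ^ DIM('a) * vol B" unfolding Z_def by (simp add: vol_scaleR_image)
  have vm: "vol (uminus ` B) = vol B" using vol_reflect[of 0 B] by simp
  have f0: "f z = 0" if "z \<notin> Z" for z
  proof -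
    have "B \<inter> (+) z ` uminus ` B = {}"
    proof (rule ccontr)
      assume "B \<inter> (+) z ` uminus ` B \<noteq> {}"
      then obtain b where b: "b \<in> B" "z - b \<in> B" by auto
      have "(1/2) *\<^sub>R b + (1/2) *\<^sub>R (z - b) \<in> B"
        using b assms(2) by (intro convexD) auto
      then have "2 *\<^sub>R ((1/2) *\<^sub>R b + (1/2) *\<^sub>R (z - b)) \<in> Z" unfolding Z_def by blast
      then show False using that by (simp add: algebra_simps)
    qed
    then show ?thesis by (simp add: f_def)
  qed
  have "\<exists>z\<in>Z. ennreal (vol B / 2 ^ DIM('a)) \<le> f z"
  proof (rule exists_ge_average)
    show "Z \<in> sets lborel" using cZ by (simp add: borel_compact)
    show "emeasure lborel Z \<noteq> 0" "emeasure lborel Z < \<infinity>"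
      using assms(3) by (auto simp: emeasure_lborel_compact[OF cZ] vZ ennreal_eq_0_iff not_le)
    show "f \<in> borel_measurable lborel"
      unfolding f_def using borel_measurable_emeasure_Int_translate[OF assms(1) cm] by simp
    have "(\<integral>\<^sup>+z. f z * indicator Z z \<partial>lborel) = (\<integral>\<^sup>+z. f z \<partial>lborel)"
      by (intro nn_integral_cong) (auto simp: indicator_def f0)
    also have "\<dots> = ennreal (vol B * vol B)"
      unfolding f_def using nn_integral_emeasure_Int_translate[OF assms(1) cm] vm by simp
    finally show "ennreal (vol B / 2 ^ DIM('a)) * emeasure lborel Z \<le> (\<integral>\<^sup>+z. f z * indicator Z z \<partial>lborel)"
      by (simp add: emeasure_lborel_compact[OF cZ] vZ flip: ennreal_mult'')
  qed auto
  then obtain z where z: "z \<in> Z" "ennreal (vol B / 2 ^ DIM('a)) \<le> f z" by blast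
  then obtain c where c: "z = 2 *\<^sub>R c" by (auto simp: Z_def)
  have eq: "(+) z ` uminus ` B = (\<lambda>x. 2 *\<^sub>R c - x) ` B"
    unfolding c image_image by simp
  have "compact (B \<inter> (+) z ` uminus ` B)"
    using assms(1) cm by (intro compact_Int compact_translation)
  then have "f z = ennreal (vol (B \<inter> (+) z ` uminus ` B))"
    unfolding f_def by (rule emeasure_lborel_compact)
  then show ?thesis
    using z(2) unfolding eq by auto
qed

text \<open>
  The translates \<open>z + B\<close> containing a given \<open>l \<in> L\<close> have \<open>z \<in> l - B \<subseteq> Z\<close>. So for \<open>z\<close> uniform
  in \<open>Z\<close> each \<open>l\<close> is covered with probability \<open>vol B / vol Z\<close>.
\<close>

lemma exists_translate_covering_average:
  fixes B Z :: "'a::euclidean_space set"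
  assumes "finite L" "compact B" "compact Z" "vol Z > 0"
    and sub: "\<And>l b. l \<in> L \<Longrightarrow> b \<in> B \<Longrightarrow> l - b \<in> Z"
  shows "\<exists>z. vol B / vol Z * card L \<le> card {l \<in> L. l - z \<in> B}"
proof -
  define f :: "'a \<Rightarrow> ennreal" where "f z = (\<Sum>l\<in>L. indicator ((\<lambda>x. l - x) ` B) z)" for z
  have cp: "compact ((\<lambda>x. l - x) ` B)" for l
    using assms(2) by (intro compact_continuous_image continuous_intros)
  have [measurable]: "(\<lambda>x. l - x) ` B \<in> sets borel" for l
    using cp by (rule borel_compact)
  have f0: "f z = 0" if "z \<notin> Z" for z
    unfolding f_def using that sub by (intro sum.neutral) (auto simp: indicator_def)
  have "\<exists>z\<in>Z. ennreal (vol B / vol Z * card L) \<le> f z"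
  proof (rule exists_ge_average)
    show "Z \<in> sets lborel" using assms(3) by (simp add: borel_compact)
    show "emeasure lborel Z \<noteq> 0" "emeasure lborel Z < \<infinity>"
      using assms(4) by (auto simp: emeasure_lborel_compact[OF assms(3)] ennreal_eq_0_iff not_le)
    show "f \<in> borel_measurable lborel"
      unfolding f_def by measurable
    have "(\<integral>\<^sup>+z. f z * indicator Z z \<partial>lborel) = (\<integral>\<^sup>+z. f z \<partial>lborel)"
      by (intro nn_integral_cong) (auto simp: indicator_def f0)
    also have "\<dots> = (\<Sum>l\<in>L. \<integral>\<^sup>+z. indicator ((\<lambda>x. l - x) ` B) z \<partial>lborel)"
      unfolding f_def by (rule nn_integral_sum) measurable
    also have "\<dots> = (\<Sum>l\<in>L. ennreal (vol B))"
      using cp by (simp add: emeasure_lborel_compact vol_reflect)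
    also have "\<dots> = ennreal (vol B * card L)"
      by (simp add: ennreal_of_nat_eq_real_of_nat ennreal_mult' mult.commute)
    finally show "ennreal (vol B / vol Z * card L) * emeasure lborel Z \<le> (\<integral>\<^sup>+z. f z * indicator Z z \<partial>lborel)"
      using assms(4) by (simp add: emeasure_lborel_compact[OF assms(3)] flip: ennreal_mult'')
  qed auto
  then obtain z where z: "ennreal (vol B / vol Z * card L) \<le> f z" by blast
  have "f z = (\<Sum>l\<in>L. of_bool (l - z \<in> B))"
    unfolding f_def by (intro sum.cong refl)
      (simp add: indicator_def mem_reflect_iff)
  also have "\<dots> = of_nat (card {l \<in> L. l - z \<in> B})"
    using assms(1) by (simp add: Int_def)
  also have "\<dots> = ennreal (card {l \<in> L. l - z \<in> B})"
    by (simp add: ennreal_of_nat_eq_real_of_nat)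
  finally show ?thesis using z by auto
qed

section \<open>Covering by translates of a convex body\<close>

lemma exists_partial_greedy_cover:
  fixes B :: "'a::ab_group_add set" and r :: real
  assumes "finite L" "r \<le> 1"
    and greedy: "\<And>L'. L' \<subseteq> L \<Longrightarrow> \<exists>z. r * card L' \<le> card {l \<in> L'. l - z \<in> B}"
  shows "\<exists>P. finite P \<and> card P \<le> m \<and>
    card {l \<in> L. \<forall>p\<in>P. l - p \<notin> B} \<le> (1 - r) ^ m * card L"
proof (induction m)
  case 0
  show ?case by (intro exI[of _ "{}"]) simp
next
  case (Suc m)
  then obtain P where P: "finite P" "card P \<le> m"
    "card {l \<in> L. \<forall>p\<in>P. l - p \<notin> B} \<le> (1 - r) ^ m * card L" by blast
  define U where "U = {l \<in> L. \<forall>p\<in>P. l - p \<notin> B}"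
  have finU: "finite U" using assms(1) by (simp add: U_def)
  obtain z where z: "r * card U \<le> card {l \<in> U. l - z \<in> B}"
    using greedy[of U] by (auto simp: U_def)
  have "{l \<in> L. \<forall>p\<in>insert z P. l - p \<notin> B} = U - {l \<in> U. l - z \<in> B}"
    by (auto simp: U_def)
  then have "real (card {l \<in> L. \<forall>p\<in>insert z P. l - p \<notin> B})
      = real (card U) - real (card {l \<in> U. l - z \<in> B})"
    using finU by (simp add: card_Diff_subset of_nat_diff card_mono)
  also have "\<dots> \<le> (1 - r) * card U" using z by (simp add: algebra_simps)
  also have "\<dots> \<le> (1 - r) * ((1 - r) ^ m * card L)"
    using P(3) assms(2) unfolding U_def by (intro mult_left_mono) auto
  finally have "card {l \<in> L. \<forall>p\<in>insert z P. l - p \<notin> B} \<le> (1 - r) ^ Suc m * card L"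
    by simp
  moreover have "card (insert z P) \<le> Suc m"
    using P(1,2) by (simp add: card_insert_if)
  ultimately show ?case using P(1) by (intro exI[of _ "insert z P"]) simp
qed

text \<open>
  With \<open>m\<close> just above \<open>ln (M r) / r\<close>, greedy choices leave at most
  \<open>M (1 - r)^m \<le> M exp (- r m) \<le> 1 / r\<close> points, each of which gets a translate of its own.
  The final summand \<open>1\<close> pays for rounding \<open>m\<close> up.
\<close>

lemma exists_greedy_cover:
  fixes B :: "'a::ab_group_add set" and r M :: real
  assumes "finite L" "0 < r" "r \<le> 1" "B \<noteq> {}"
    and greedy: "\<And>L'. L' \<subseteq> L \<Longrightarrow> \<exists>z. r * card L' \<le> card {l \<in> L'. l - z \<in> B}"
    and M: "card L \<le> M" "1 \<le> M * r"
  shows "\<exists>P. finite P \<and> (\<forall>l\<in>L. \<exists>p\<in>P. l - p \<in> B) \<and> card P \<le> (ln (M * r) + 1) / r + 1"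
proof -
  define m where "m = nat \<lceil>ln (M * r) / r\<rceil>"
  have ln0: "0 \<le> ln (M * r) / r" using M(2) assms(2) by simp
  have m: "ln (M * r) / r \<le> m" "m \<le> ln (M * r) / r + 1"
    unfolding m_def using ln0 by linarith+
  have M0: "0 \<le> M" using M(1) by (meson of_nat_0_le_iff order_trans)
  obtain P where P: "finite P" "card P \<le> m"
    "card {l \<in> L. \<forall>p\<in>P. l - p \<notin> B} \<le> (1 - r) ^ m * card L"
    using exists_partial_greedy_cover[OF assms(1,3) greedy, of m] by blast
  define U where "U = {l \<in> L. \<forall>p\<in>P. l - p \<notin> B}"
  have finU: "finite U" using assms(1) by (simp add: U_def)
  obtain b where b: "b \<in> B" using assms(4) by blast
  have "(1 - r) ^ m \<le> exp (- r) ^ m"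
    using assms(3) exp_ge_add_one_self[of "- r"] by (intro power_mono) auto
  also have "\<dots> = exp (- (r * m))" by (simp add: exp_of_nat_mult[symmetric] mult.commute)
  also have "\<dots> \<le> exp (- ln (M * r))"
    using m(1) assms(2) by (simp add: field_simps)
  also have "\<dots> = 1 / (M * r)" using M(2) by (simp add: exp_minus field_simps)
  finally have pw: "(1 - r) ^ m \<le> 1 / (M * r)" .
  have "card U \<le> (1 - r) ^ m * card L" using P(3) by (simp add: U_def)
  also have "\<dots> \<le> 1 / (M * r) * M"
    using pw M(1,2) M0 by (intro mult_mono) auto
  also have "\<dots> = 1 / r" using M(2) by auto
  finally have U: "card U \<le> 1 / r" .
  let ?Q = "P \<union> (\<lambda>l. l - b) ` U"
  have "card ?Q \<le> card P + card U"
    using card_Un_le[of P "(\<lambda>l. l - b) ` U"] card_image_le[OF finU, of "\<lambda>l. l - b"] by linarith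
  then have "real (card ?Q) \<le> real m + card U" using P(2) by linarith
  also have "\<dots> \<le> (ln (M * r) + 1) / r + 1"
    using m(2) U by (simp add: add_divide_distrib)
  finally have "card ?Q \<le> (ln (M * r) + 1) / r + 1" .
  moreover have "\<forall>l\<in>L. \<exists>p\<in>?Q. l - p \<in> B"
  proof
    fix l assume l: "l \<in> L"
    show "\<exists>p\<in>?Q. l - p \<in> B"
    proof (cases "l \<in> U")
      case True
      then show ?thesis using b by (intro bexI[of _ "l - b"]) auto
    next
      case False
      then show ?thesis using l by (auto simp: U_def)
    qed
  qed
  ultimately show ?thesis using P(1) finU by (intro exI[of _ ?Q]) blast
qed

text \<open>
  Choose \<open>L\<close> of maximal size such that the sets \<open>l + h S\<close> for \<open>l \<in> L\<close> are pairwise disjoint.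
  They are packed into \<open>Z\<close>, which bounds the size, and by maximality every \<open>a + h S\<close> meets some
  \<open>l + h S\<close>, which for symmetric convex \<open>S\<close> means \<open>a \<in> l + 2 h S\<close>.
\<close>

lemma exists_net:
  fixes A S Z :: "'a::euclidean_space set"
  assumes S: "compact S" "convex S" "\<And>s. s \<in> S \<Longrightarrow> - s \<in> S" "vol S > 0"
    and "h > 0" and Z: "compact Z" "\<And>a s. a \<in> A \<Longrightarrow> s \<in> S \<Longrightarrow> a + h *\<^sub>R s \<in> Z"
  shows "\<exists>L\<subseteq>A. finite L \<and> card L * (h ^ DIM('a) * vol S) \<le> vol Z \<and>
    (\<forall>a\<in>A. \<exists>l\<in>L. \<exists>s\<in>S. a = l + (2 * h) *\<^sub>R s)"
proof -
  define T where "T l = (\<lambda>s. h *\<^sub>R s + l) ` S" for l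
  define sep where "sep L \<longleftrightarrow> finite L \<and> L \<subseteq> A \<and> disjoint_family_on T L" for L
  define v where "v = h ^ DIM('a) * vol S"
  have v: "v > 0" using assms by (simp add: v_def)
  have cT: "compact (T l)" for l
    unfolding T_def using S(1) by (intro compact_continuous_image continuous_intros)
  have bound: "card L * v \<le> vol Z" if "sep L" for L
  proof -
    have "card L * v = (\<Sum>l\<in>L. vol (T l))"
      using assms(5) by (simp add: T_def v_def vol_affine_image)
    also have "\<dots> = vol (\<Union>l\<in>L. T l)"
      using that cT
      by (intro measure_finite_Union[symmetric])
        (auto simp: sep_def lmeasurable_compact fmeasurableD emeasure_lborel_compact
          compact_imp_closed emeasure_completion)
    also have "\<dots> \<le> vol Z"
      using that Z cT
      by (intro vol_mono_compact compact_UN) (auto simp: sep_def T_def subset_iff add.commute)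
    finally show ?thesis .
  qed
  have "sep {}" by (simp add: sep_def disjoint_family_on_def)
  moreover have "\<forall>L. sep L \<longrightarrow> card L < Suc (nat \<lceil>vol Z / v\<rceil>)"
  proof (intro allI impI)
    fix L assume "sep L"
    then have "card L \<le> vol Z / v" using bound v by (simp add: field_simps)
    then show "card L < Suc (nat \<lceil>vol Z / v\<rceil>)" by linarith
  qed
  ultimately have "\<exists>L. sep L \<and> (\<forall>L'. sep L' \<longrightarrow> card L' \<le> card L)"
    by (rule ex_has_greatest_nat)
  then obtain L where L: "sep L" "\<And>L'. sep L' \<Longrightarrow> card L' \<le> card L" by blast
  have "\<exists>l\<in>L. \<exists>s\<in>S. a = l + (2 * h) *\<^sub>R s" if a: "a \<in> A" for a
  proof -
    have mid: "(1/2) *\<^sub>R s + (1/2) *\<^sub>R (- t) \<in> S" if "s \<in> S" "t \<in> S" for s t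
      using that S(2,3) by (intro convexD) auto
    show ?thesis
    proof (cases "a \<in> L")
      case True
      obtain s where "s \<in> S" using S(4) by fastforce
      then have "0 \<in> S" using mid[of s s] by simp
      then show ?thesis using True by (intro bexI[of _ a] bexI[of _ 0]) auto
    next
      case False
      then have "card (insert a L) > card L" using L(1) by (simp add: sep_def)
      then have "\<not> sep (insert a L)" using L(2) by (meson not_le)
      then have "\<not> disjoint_family_on T (insert a L)"
        using L(1) a by (simp add: sep_def)
      then obtain l where l: "l \<in> L" "T a \<inter> T l \<noteq> {}"
        using L(1) False by (auto simp: sep_def disjoint_family_on_insert)
      then obtain s t where st: "s \<in> S" "t \<in> S" "h *\<^sub>R s + a = h *\<^sub>R t + l"
        by (auto simp: T_def)
      have "a = h *\<^sub>R t + l - h *\<^sub>R s" using st(3) by (simp add: algebra_simps)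
      also have "\<dots> = l + (2 * h) *\<^sub>R ((1/2) *\<^sub>R t + (1/2) *\<^sub>R (- s))"
        by (simp add: algebra_simps)
      finally show ?thesis using l(1) mid[OF st(2,1)] by blast
    qed
  qed
  then show ?thesis
    using L(1) bound[OF L(1)] by (intro exI[of _ L]) (auto simp: sep_def v_def)
qed

text \<open>
  The net is taken with respect to the symmetric body \<open>S = B \<inter> - B\<close> at scale \<open>\<eta>\<close>, and its
  points are covered by translates of \<open>(1 - \<eta>) B\<close>. A point of \<open>A\<close> then lies in
  \<open>l + \<eta> S \<subseteq> p + (1 - \<eta>) B + \<eta> B = p + B\<close>. Both the packing \<open>L + (\<eta>/2) S\<close> and the admissible
  translation vectors stay in the one set \<open>Z = A - B\<close>, so \<open>vol Z\<close> cancels in the logarithm.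
\<close>

lemma covering_number_bound_centered:
  fixes A B :: "'a::euclidean_space set"
  assumes A: "compact A" "A \<noteq> {}" and B: "compact B" "convex B" "vol B > 0"
    and sym: "vol B / 2 ^ DIM('a) \<le> vol (B \<inter> uminus ` B)"
    and e: "0 < \<eta>" "\<eta> < 1" "1 \<le> 4 * (1 - \<eta>) / \<eta>"
  defines "Z \<equiv> {a - b | a b. a \<in> A \<and> b \<in> B}"
  shows "\<exists>P. finite P \<and> (\<forall>a\<in>A. \<exists>p\<in>P. a - p \<in> B) \<and>
    card P \<le> (DIM('a) * ln (4 * (1 - \<eta>) / \<eta>) + 1) * (vol Z / vol B / (1 - \<eta>) ^ DIM('a)) + 1"
proof -
  define d where "d = DIM('a)"
  define S where "S = B \<inter> uminus ` B"
  have cS: "compact S" unfolding S_def using B(1) by (intro compact_Int compact_negations)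
  have vS: "vol B / 2 ^ d \<le> vol S" using sym by (simp add: S_def d_def)
  moreover have "0 < vol B / 2 ^ d" using B(3) by simp
  ultimately have vS0: "0 < vol S" by linarith
  have convS: "convex S" unfolding S_def using B(2) by (intro convex_Int convex_negations)
  have symS: "- s \<in> S" if "s \<in> S" for s using that by (auto simp: S_def)
  obtain s where s: "s \<in> S" using vS0 by fastforce
  have "(1/2) *\<^sub>R s + (1/2) *\<^sub>R (- s) \<in> S"
    using s symS[OF s] convS by (intro convexD) auto
  then have "0 \<in> B" by (simp add: S_def)
  then have shrink: "t *\<^sub>R b \<in> B" if "b \<in> B" "0 \<le> t" "t \<le> 1" for t b
    using convexD[OF B(2) that(1) \<open>0 \<in> B\<close>, of t "1 - t"] that by simp
  have cZ: "compact Z" unfolding Z_def using A(1) B(1) by (rule compact_differences)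
  obtain a0 where a0: "a0 \<in> A" using A(2) by blast
  define B1 where "B1 = (*\<^sub>R) (1 - \<eta>) ` B"
  have cB1: "compact B1" unfolding B1_def using B(1) by (rule compact_scaling)
  have vB1: "vol B1 = (1 - \<eta>) ^ d * vol B" using e by (simp add: B1_def vol_scaleR_image d_def)
  have B1B: "b \<in> B" if "b \<in> B1" for b using that shrink e by (auto simp: B1_def)
  have "vol B1 = vol ((\<lambda>b. a0 - b) ` B1)" by (simp add: vol_reflect)
  also have "\<dots> \<le> vol Z"
    using cB1 cZ a0 B1B
    by (intro vol_mono_compact compact_continuous_image continuous_intros) (auto simp: Z_def)
  finally have B1Z: "vol B1 \<le> vol Z" .
  have vB10: "vol B1 > 0" using e B(3) by (simp add: vB1)
  then have vZ0: "vol Z > 0" using B1Z by linarith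
  obtain L where L: "L \<subseteq> A" "finite L" "card L * ((\<eta> / 2) ^ d * vol S) \<le> vol Z"
    "\<forall>a\<in>A. \<exists>l\<in>L. \<exists>s\<in>S. a = l + (2 * (\<eta> / 2)) *\<^sub>R s"
  proof -
    have "a + (\<eta> / 2) *\<^sub>R s \<in> Z" if "a \<in> A" "s \<in> S" for a s
    proof -
      have "(\<eta> / 2) *\<^sub>R (- s) \<in> B"
        using that(2) symS e by (intro shrink) (auto simp: S_def)
      then have "a - (\<eta> / 2) *\<^sub>R (- s) \<in> Z" unfolding Z_def using that(1) by blast
      then show ?thesis by simp
    qed
    then show ?thesis
      using exists_net[OF cS convS symS vS0 _ cZ, of "\<eta> / 2" A] e(1) that by (auto simp: d_def)
  qed
  define M where "M = vol Z * 4 ^ d / (\<eta> ^ d * vol B)"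
  define r where "r = vol B1 / vol Z"
  have "card L * ((\<eta> / 2) ^ d * (vol B / 2 ^ d)) \<le> card L * ((\<eta> / 2) ^ d * vol S)"
    using vS e(1) by (intro mult_left_mono) auto
  also have "\<dots> \<le> vol Z" by (rule L(3))
  finally have "card L * (\<eta> ^ d * vol B / 4 ^ d) \<le> vol Z"
    by (simp add: power_divide power_mult_distrib[symmetric])
  \<comment> \<open>The factor \<open>4\<close> has one \<open>2\<close> from halving \<open>\<eta>\<close> in the packing and one from the loss in \<open>vol S\<close>.\<close>
  then have cardL: "card L \<le> M"
    using e(1) B(3) by (simp add: M_def field_simps)
  have Mr: "M * r = (4 * (1 - \<eta>) / \<eta>) ^ d"
    using vZ0 B(3) e(1)
    by (simp add: M_def r_def vB1 power_divide power_mult_distrib del: right_diff_distrib_numeral)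
  have "1 \<le> M * r" unfolding Mr using e(3) by (rule one_le_power)
  have "\<exists>P. finite P \<and> (\<forall>l\<in>L. \<exists>p\<in>P. l - p \<in> B1) \<and> card P \<le> (ln (M * r) + 1) / r + 1"
  proof (rule exists_greedy_cover[OF L(2)])
    show "0 < r" "r \<le> 1" using vB10 vZ0 B1Z by (auto simp: r_def)
    show "B1 \<noteq> {}" using vB10 by auto
    show "\<exists>z. r * card L' \<le> card {l \<in> L'. l - z \<in> B1}" if "L' \<subseteq> L" for L'
      unfolding r_def
    proof (rule exists_translate_covering_average[OF _ cB1 cZ vZ0])
      show "finite L'" using that L(2) by (rule finite_subset)
      show "l - b \<in> Z" if "l \<in> L'" "b \<in> B1" for l b
        using that B1B \<open>L' \<subseteq> L\<close> L(1) unfolding Z_def by blast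
    qed
  qed fact+
  then obtain P where P: "finite P" "\<forall>l\<in>L. \<exists>p\<in>P. l - p \<in> B1"
    "card P \<le> (ln (M * r) + 1) / r + 1" by blast
  have cover: "\<forall>a\<in>A. \<exists>p\<in>P. a - p \<in> B"
  proof
    fix a assume "a \<in> A"
    obtain l s where ls: "l \<in> L" "s \<in> S" "a = l + \<eta> *\<^sub>R s" using L(4) \<open>a \<in> A\<close> by force
    obtain p where "p \<in> P" "l - p \<in> B1" using P(2) ls(1) by blast
    then obtain b where p: "p \<in> P" "l - p = (1 - \<eta>) *\<^sub>R b" "b \<in> B"
      by (auto simp: B1_def)
    have "(1 - \<eta>) *\<^sub>R b + \<eta> *\<^sub>R s \<in> B"
      using p(3) ls(2) e B(2) by (intro convexD) (auto simp: S_def)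
    moreover have "a - p = (1 - \<eta>) *\<^sub>R b + \<eta> *\<^sub>R s"
      using p(2) ls(3) by (simp add: algebra_simps)
    ultimately show "\<exists>p\<in>P. a - p \<in> B" using p(1) by (intro bexI[of _ p]) simp_all
  qed
  have lnMr: "ln (M * r) = d * ln (4 * (1 - \<eta>) / \<eta>)"
    unfolding Mr using e by (simp add: ln_realpow)
  have cardP: "card P \<le> (d * ln (4 * (1 - \<eta>) / \<eta>) + 1) * (vol Z / vol B / (1 - \<eta>) ^ d) + 1"
  proof -
    have "vol Z / vol B / (1 - \<eta>) ^ d = 1 / r"
      by (simp add: r_def vB1 mult.commute)
    then show ?thesis using P(3) lnMr by simp
  qed
  show ?thesis
    using P(1) cover cardP unfolding d_def by (intro exI[of _ P] conjI)
qed

text \<open>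
  Moving the centre of a large symmetric part of \<open>B\<close> to the origin changes \<open>A - B\<close> and the
  covering translates only by a translation.
\<close>

lemma covering_number_bound:
  fixes A B :: "'a::euclidean_space set"
  assumes A: "compact A" "A \<noteq> {}" and B: "compact B" "convex B" "vol B > 0"
    and e: "0 < \<eta>" "\<eta> < 1" "1 \<le> 4 * (1 - \<eta>) / \<eta>"
  defines "Z \<equiv> {a - b | a b. a \<in> A \<and> b \<in> B}"
  shows "\<exists>P. finite P \<and> (\<forall>a\<in>A. \<exists>p\<in>P. a - p \<in> B) \<and>
    card P \<le> (DIM('a) * ln (4 * (1 - \<eta>) / \<eta>) + 1) * (vol Z / vol B / (1 - \<eta>) ^ DIM('a)) + 1"
proof -
  obtain c where c: "vol B / 2 ^ DIM('a) \<le> vol (B \<inter> (\<lambda>x. 2 *\<^sub>R c - x) ` B)"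
    using exists_large_symmetric_part[OF B] by blast
  define B0 where "B0 = (+) (- c) ` B"
  define Z0 where "Z0 = {a - b | a b. a \<in> A \<and> b \<in> B0}"
  have vB0: "vol B0 = vol B" unfolding B0_def by (rule measure_translation)
  have mem: "x \<in> B0 \<longleftrightarrow> x + c \<in> B" for x
    unfolding B0_def mem_translate_iff by simp
  have "Z0 = (+) c ` Z"
  proof (rule set_eqI)
    fix x
    have "x \<in> Z0 \<longleftrightarrow> (\<exists>a\<in>A. \<exists>b\<in>B. x = a - (b - c))"
      unfolding Z0_def B0_def by auto
    also have "\<dots> \<longleftrightarrow> (\<exists>a\<in>A. \<exists>b\<in>B. x - c = a - b)"
      by (intro bex_cong refl) (auto simp: algebra_simps)
    also have "\<dots> \<longleftrightarrow> x \<in> (+) c ` Z"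
      unfolding mem_translate_iff Z_def by auto
    finally show "x \<in> Z0 \<longleftrightarrow> x \<in> (+) c ` Z" .
  qed
  then have vZ0: "vol Z0 = vol Z" by (simp add: measure_translation)
  have "B0 \<inter> uminus ` B0 = (+) (- c) ` (B \<inter> (\<lambda>x. 2 *\<^sub>R c - x) ` B)"
  proof (rule set_eqI)
    fix x
    have "x \<in> uminus ` B0 \<longleftrightarrow> c - x \<in> B"
      using mem_reflect_iff[of x 0 B0] mem[of "- x"] by simp
    moreover have "x \<in> (+) (- c) ` (B \<inter> (\<lambda>x. 2 *\<^sub>R c - x) ` B) \<longleftrightarrow> x + c \<in> B \<and> c - x \<in> B"
      unfolding mem_translate_iff Int_iff mem_reflect_iff by (simp add: scaleR_2 algebra_simps)
    ultimately show "x \<in> B0 \<inter> uminus ` B0 \<longleftrightarrow> x \<in> (+) (- c) ` (B \<inter> (\<lambda>x. 2 *\<^sub>R c - x) ` B)"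
      by (simp add: mem)
  qed
  then have "vol B0 / 2 ^ DIM('a) \<le> vol (B0 \<inter> uminus ` B0)"
    using c by (simp only: vB0 measure_translation)
  moreover have "compact B0" "convex B0" "vol B0 > 0"
    using compact_translation[OF B(1), of "- c"] convex_translation[OF B(2), of "- c"] B(3) vB0
    by (simp_all only: B0_def)
  ultimately obtain P where P: "finite P" "\<forall>a\<in>A. \<exists>p\<in>P. a - p \<in> B0"
    "card P \<le> (DIM('a) * ln (4 * (1 - \<eta>) / \<eta>) + 1) * (vol Z / vol B / (1 - \<eta>) ^ DIM('a)) + 1"
    using covering_number_bound_centered[OF A _ _ _ _ e, of B0] vB0 vZ0 by (auto simp: Z0_def)
  have "\<forall>a\<in>A. \<exists>p\<in>(\<lambda>p. p - c) ` P. a - p \<in> B"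
    using P(2) by (auto simp: mem algebra_simps)
  moreover have "real (card ((\<lambda>p. p - c) ` P)) \<le> card P"
    using card_image_le[OF P(1)] by simp
  then have "card ((\<lambda>p. p - c) ` P)
      \<le> (DIM('a) * ln (4 * (1 - \<eta>) / \<eta>) + 1) * (vol Z / vol B / (1 - \<eta>) ^ DIM('a)) + 1"
    using P(3) by (rule order_trans)
  ultimately show ?thesis
    using P(1) by (intro exI[of _ "(\<lambda>p. p - c) ` P"] conjI finite_imageI)
qed

section \<open>The choice of the scale of the net\<close>

lemma ln_three_halves_le: "ln (3/2 :: real) \<le> 11/24"
proof -
  have "ln (3/2 :: real) = ln (9/8 * (4/3))" by simp
  also have "\<dots> = ln (9/8) + ln (4/3)" by (rule ln_mult_pos) auto
  also have "\<dots> \<le> 11/24"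
    using ln_add_one_self_le_self[of "1/8::real"] ln_add_one_self_le_self[of "1/3::real"] by simp
  finally show ?thesis .
qed

text \<open>
  The plane is treated by itself because the estimates for larger \<open>n\<close> rely on \<open>ln n \<ge> 1\<close>.
  At the scale \<open>1/10\<close> the bound holds with little to spare, so the logarithms need good estimates.
\<close>

lemma covering_constant_arithmetic_2:
  "(2 * ln (4 * (1 - 1/10) / (1/10)) + 1) / (1 - 1/10 :: real) ^ 2 + 1/4
    \<le> 2 * ln 2 + 2 * ln (ln 2) + 5 * 2"
proof -
  have "ln (36::real) = ln (2 ^ 5 * (9/8))" by simp
  also have "\<dots> = 5 * ln 2 + ln (9/8)"
    by (subst ln_mult_pos, simp, simp) (subst ln_realpow, auto)
  also have "\<dots> \<le> 5 * (25/36) + 1/8"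
    using ln2_le_25_over_36 ln_add_one_self_le_self[of "1/8::real"] by simp
  finally have ln36: "ln (36::real) \<le> 5 * (25/36) + 1/8" .
  have "- ln (3/2) = ln (2/3 :: real)"
    using ln_div[of 1 "3/2::real"] by simp
  also have "\<dots> \<le> ln (ln 2)"
    using ln2_ge_two_thirds by (intro ln_mono) auto
  finally have "ln (ln 2 :: real) \<ge> - 11/24"
    using ln_three_halves_le by simp
  moreover have "(1 - 1/10 :: real) ^ 2 = 81/100" by (simp add: power2_eq_square)
  moreover have "4 * (1 - 1/10) / (1/10) = (36::real)" by simp
  ultimately show ?thesis
    using ln36 ln2_ge_two_thirds by (simp add: field_simps)
qed

text \<open>
  With this \<open>\<eta>\<close>, Bernoulli's inequality gives \<open>(1 - \<eta>)^n \<ge> 1 - n \<eta> = (L + 1) / (L + 2)\<close>, so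
  dividing by \<open>(1 - \<eta>)^n\<close> increases a numerator \<open>X\<close> of order \<open>n L\<close> only by \<open>X / (L + 1)\<close>,
  which is of order \<open>n\<close>. The hypothesis \<open>n \<ge> 3\<close> enters mainly through \<open>L \<ge> 1\<close>.
\<close>

lemma covering_constant_arithmetic_ge_3:
  fixes n :: nat and L \<eta> :: real
  assumes "n \<ge> 3"
  defines "L \<equiv> ln (real n)"
  defines "\<eta> \<equiv> 1 / (real n * (L + 2))"
  shows "0 < \<eta>" "\<eta> < 1" "1 \<le> 4 * (1 - \<eta>) / \<eta>"
    and "(n * ln (4 * (1 - \<eta>) / \<eta>) + 1) / (1 - \<eta>) ^ n + 1/4 \<le> n * L + n * ln L + 5 * real n"
proof -
  have n: "real n \<ge> 3" using assms(1) by simp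
  have "exp 1 \<le> real n" using exp_le n by linarith
  then have L: "L \<ge> 1" using n by (simp add: L_def ln_ge_iff)
  have prod: "real n * (L + 2) \<ge> 3 * 3" using n L by (intro mult_mono) auto
  show e0: "0 < \<eta>" using prod by (simp add: \<eta>_def)
  have e9: "\<eta> \<le> 1/9" unfolding \<eta>_def using prod by (simp add: divide_le_eq)
  then show "\<eta> < 1" by simp
  have quot: "1 \<le> (1 - \<eta>) / \<eta>" using e0 e9 by (simp add: field_simps)
  then show arg: "1 \<le> 4 * (1 - \<eta>) / \<eta>"
    unfolding times_divide_eq_right[symmetric] by linarith
  have ln12: "ln (12::real) \<le> 61/24" "ln (12::real) \<ge> 4/3" "ln (12::real) = ln 4 + ln 3"
  proof -
    have "ln (12::real) = ln (2 ^ 3 * (3/2))" by simp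
    also have "\<dots> = 3 * ln 2 + ln (3/2)" by (subst ln_mult_pos, simp, simp) (subst ln_realpow, auto)
    finally have eq: "ln (12::real) = 3 * ln 2 + ln (3/2)" .
    then show "ln (12::real) \<le> 61/24"
      using ln2_le_25_over_36 ln_three_halves_le by simp
    have "ln (3/2::real) \<ge> 0" by simp
    then show "ln (12::real) \<ge> 4/3" using eq ln2_ge_two_thirds by linarith
    show "ln (12::real) = ln 4 + ln 3" using ln_mult_pos[of "4::real" 3] by simp
  qed
  \<comment> \<open>The first bound keeps \<open>ln L\<close>, which has to reappear exactly;
    the second, by the tangent at \<open>L = 1\<close>, is linear and serves inside \<open>X / (L + 1)\<close>.\<close>
  have lnL2: "ln (L + 2) \<le> ln 3 + ln L"
  proof -
    have "ln (L + 2) \<le> ln (3 * L)" using L by (intro ln_mono) auto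
    also have "\<dots> = ln 3 + ln L" using L by (intro ln_mult_pos) auto
    finally show ?thesis .
  qed
  have lnL2': "ln (L + 2) \<le> ln 3 + (L - 1) / 3"
  proof -
    have "L + 2 = 3 * ((L + 2) / 3)" by simp
    then have "ln (L + 2) = ln (3 * ((L + 2) / 3))" by (rule arg_cong)
    also have "\<dots> = ln 3 + ln ((L + 2) / 3)" using L by (intro ln_mult_pos) auto
    also have "ln ((L + 2) / 3) \<le> (L + 2) / 3 - 1" using L by (intro ln_le_minus_one) auto
    finally show ?thesis by (simp add: diff_divide_distrib add_divide_distrib)
  qed
  define X where "X = n * (ln 4 + L + ln (L + 2)) + 1"
  have "ln (4 * (1 - \<eta>) / \<eta>) \<le> ln (4 * (real n * (L + 2)))"
  proof (rule ln_mono)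
    have "4 * (1 - \<eta>) / \<eta> \<le> 4 * 1 / \<eta>" using e0 by (intro divide_right_mono mult_left_mono) auto
    then show "4 * (1 - \<eta>) / \<eta> \<le> 4 * (real n * (L + 2))" by (simp add: \<eta>_def)
  qed (use arg in auto)
  also have "\<dots> = ln 4 + ln (real n * (L + 2))"
    using prod by (intro ln_mult_pos) auto
  also have "ln (real n * (L + 2)) = L + ln (L + 2)"
    using n L unfolding L_def by (intro ln_mult_pos) auto
  finally have "n * ln (4 * (1 - \<eta>) / \<eta>) \<le> n * (ln 4 + (L + ln (L + 2)))"
    by (rule mult_left_mono) simp
  then have num: "n * ln (4 * (1 - \<eta>) / \<eta>) + 1 \<le> X"
    by (simp add: X_def algebra_simps)
  have ne: "real n * \<eta> = 1 / (L + 2)" using n by (simp add: \<eta>_def)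
  have "(L + 1) / (L + 2) = 1 - 1 / (L + 2)" using L by (simp add: field_simps)
  also have "\<dots> = 1 + real n * (- \<eta>)" using ne by simp
  also have "\<dots> \<le> (1 + (- \<eta>)) ^ n" using e9 by (intro Bernoulli_inequality) auto
  finally have den: "(L + 1) / (L + 2) \<le> (1 - \<eta>) ^ n" by simp
  have X_nonneg: "X \<ge> 0"
    unfolding X_def using L by (intro add_nonneg_nonneg mult_nonneg_nonneg) auto
  have "(n * ln (4 * (1 - \<eta>) / \<eta>) + 1) / (1 - \<eta>) ^ n \<le> X / ((L + 1) / (L + 2))"
    using num den L X_nonneg by (intro frac_le) auto
  also have "\<dots> = X + X / (L + 1)" using L by (simp add: field_simps)
  also have "X / (L + 1) \<le> n * (2/3 + ln 12 / 2)"
  proof -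
    have "X \<le> n * (ln 4 + L + ln (L + 2)) + n * (1/3)" using n by (simp add: X_def)
    also have "\<dots> = n * (ln 4 + L + ln (L + 2) + 1/3)" by (simp add: algebra_simps)
    also have "\<dots> \<le> n * ((2/3 + ln 12 / 2) * (L + 1))"
    proof (rule mult_left_mono)
      have "0 \<le> (ln 12 / 2 - 2/3) * (L - 1)" using L ln12 by (intro mult_nonneg_nonneg) auto
      then have "4 * L / 3 + ln 12 \<le> (2/3 + ln 12 / 2) * (L + 1)"
        by (simp add: algebra_simps diff_divide_distrib add_divide_distrib)
      moreover have "ln 4 + L + ln (L + 2) + 1/3 \<le> 4 * L / 3 + ln 12"
        using lnL2' by (simp add: ln12(3) diff_divide_distrib)
      ultimately show "ln 4 + L + ln (L + 2) + 1/3 \<le> (2/3 + ln 12 / 2) * (L + 1)"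
        by (rule order_trans[rotated])
    qed simp
    finally show ?thesis using L by (simp add: divide_le_eq mult.assoc)
  qed
  finally have "(n * ln (4 * (1 - \<eta>) / \<eta>) + 1) / (1 - \<eta>) ^ n + 1/4
      \<le> n * (ln 4 + L + ln (L + 2)) + n * (2/3 + ln 12 / 2) + 5/4"
    by (simp add: X_def)
  also have "\<dots> \<le> n * (ln 4 + L + ln (L + 2)) + n * (2/3 + ln 12 / 2) + n * (5/12)"
    using n by simp
  also have "\<dots> = n * (ln 4 + L + ln (L + 2) + 2/3 + ln 12 / 2 + 5/12)"
    by (simp add: algebra_simps)
  also have "\<dots> \<le> n * (L + ln L + 5)"
    using lnL2 ln12 by (intro mult_left_mono) (auto simp: add_divide_distrib)
  also have "\<dots> = n * L + n * ln L + 5 * real n" by (simp add: algebra_simps)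
  finally show "(n * ln (4 * (1 - \<eta>) / \<eta>) + 1) / (1 - \<eta>) ^ n + 1/4 \<le> n * L + n * ln L + 5 * real n" .
qed

text \<open>
  The summand \<open>1/4\<close> stands for the rounding term \<open>1\<close> of the covering bound divided by
  \<open>vol (2K - K) / vol K \<ge> 2^n \<ge> 4\<close>.
\<close>

lemma covering_constant_arithmetic:
  fixes n :: nat
  assumes "n \<ge> 2"
  shows "\<exists>\<eta>. 0 < \<eta> \<and> \<eta> < 1 \<and> 1 \<le> 4 * (1 - \<eta>) / \<eta> \<and>
    (n * ln (4 * (1 - \<eta>) / \<eta>) + 1) / (1 - \<eta>) ^ n + 1/4
      \<le> n * ln n + n * ln (ln n) + 5 * real n"
proof (cases "n = 2")
  case True
  then show ?thesis using covering_constant_arithmetic_2 by (intro exI[of _ "1/10"]) simp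
next
  case False
  then have "n \<ge> 3" using assms by simp
  from covering_constant_arithmetic_ge_3[OF this] show ?thesis by blast
qed

section \<open>The Rogers--Shephard inequality\<close>

text \<open>
  This is \<open>n B(n, n + 1) = n (n - 1)! n! / (2 n)!\<close>. The Beta integral is stated with
  \<open>powr\<close>, and \<open>0 powr 0 = 0\<close> while \<open>0 ^ 0 = 1\<close>, hence the passage through the open interval.
\<close>

lemma nn_integral_Beta_binomial:
  assumes "n \<ge> 1"
  shows "(\<integral>\<^sup>+s. ennreal (n * s ^ (n - 1) * (1 - s) ^ n) * indicator {0..1} s \<partial>lborel)
    = ennreal (1 / ((2 * n) choose n))"
proof (rule nn_integral_has_integral_lebesgue')
  obtain m where m: "n = Suc m" using assms by (cases n) auto
  have "((\<lambda>t. t powr (real n - 1) * (1 - t) powr (real n + 1 - 1)) has_integral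
      Beta (real n) (real n + 1)) {0<..<1}"
    using has_integral_Beta_real[of n "real n + 1"] assms by (simp add: has_integral_Icc_iff_Ioo)
  also have "?this \<longleftrightarrow> ((\<lambda>t. t ^ (n - 1) * (1 - t) ^ n) has_integral
      Beta (real n) (real n + 1)) {0<..<1}"
    by (rule has_integral_cong) (simp_all add: m powr_realpow[symmetric] powr_add)
  finally have "((\<lambda>t. n * (t ^ (n - 1) * (1 - t) ^ n)) has_integral
      n * Beta (real n) (real n + 1)) {0..1}"
    by (intro has_integral_mult_right) (simp add: has_integral_Icc_iff_Ioo)
  moreover have "n * Beta (real n) (real n + 1) = 1 / ((2 * n) choose n)"
  proof -
    have G: "Gamma (real n) = fact m" "Gamma (real n + 1) = fact n"
      using Gamma_fact[of m, where ?'a = real] Gamma_fact[of n, where ?'a = real]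
      by (simp_all add: m add.commute)
    have "real n + (real n + 1) = 1 + real (2 * n)" by simp
    then have "Gamma (real n + (real n + 1)) = fact (2 * n)"
      using Gamma_fact[of "2 * n", where ?'a = real] by (simp only:)
    moreover have "real n * fact m = fact n" by (simp add: m)
    ultimately show ?thesis
      by (simp add: Beta_def G binomial_fact mult.assoc[symmetric])
  qed
  ultimately show "((\<lambda>t. n * t ^ (n - 1) * (1 - t) ^ n) has_integral 1 / ((2 * n) choose n)) {0..1}"
    by (simp add: mult.assoc)
qed auto

text \<open>
  Both \<open>K\<close> and its translate contain the homothet \<open>s K + (1 - s) a\<close>.
\<close>

lemma Int_translate_ge_along_difference_body:
  fixes K :: "'a::euclidean_space set"
  assumes K: "compact K" "convex K" and s: "0 \<le> s" "s \<le> 1" and ab: "a \<in> K" "b \<in> K"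
  shows "s ^ DIM('a) * vol K \<le> vol (K \<inter> (+) ((1 - s) *\<^sub>R (a - b)) ` K)"
proof -
  let ?x = "(1 - s) *\<^sub>R (a - b)"
  have in_K: "s *\<^sub>R y + (1 - s) *\<^sub>R c \<in> K" if "y \<in> K" "c \<in> K" for y c
    using that K(2) s by (intro convexD) auto
  have "s ^ DIM('a) * vol K = vol ((\<lambda>y. s *\<^sub>R y + (1 - s) *\<^sub>R a) ` K)"
    using s by (simp add: vol_affine_image)
  also have "\<dots> \<le> vol (K \<inter> (+) ?x ` K)"
  proof (rule vol_mono_compact)
    show "compact ((\<lambda>y. s *\<^sub>R y + (1 - s) *\<^sub>R a) ` K)"
      using K(1) by (intro compact_continuous_image continuous_intros)
    show "compact (K \<inter> (+) ?x ` K)"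
      using K(1) by (intro compact_Int compact_translation)
    have eq: "s *\<^sub>R y + (1 - s) *\<^sub>R a - ?x = s *\<^sub>R y + (1 - s) *\<^sub>R b" for y
      by (simp add: algebra_simps)
    show "(\<lambda>y. s *\<^sub>R y + (1 - s) *\<^sub>R a) ` K \<subseteq> K \<inter> (+) ?x ` K"
      using in_K ab by (auto simp only: image_subset_iff Int_iff mem_translate_iff eq)
  qed
  finally show ?thesis .
qed

text \<open>
  Integrate \<open>vol (K \<inter> (x + K))\<close> over \<open>x\<close>. The integral is \<open>(vol K)^2\<close>. On the other hand the
  integrand is at least \<open>s^n vol K\<close> for \<open>x \<in> (1 - s) (K - K)\<close>. To avoid the gauge of \<open>K - K\<close>,
  write \<open>s^n\<close> as the integral of \<open>n s^(n - 1)\<close> and exchange the integrals: the slice at height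
  \<open>s\<close> is \<open>(1 - s) (K - K)\<close>, which leaves \<open>vol K vol (K - K)\<close> times a Beta integral.
\<close>

theorem rogers_shephard:
  fixes K :: "'a::euclidean_space set"
  assumes K: "compact K" "convex K" "vol K > 0"
  shows "vol {x - y | x y. x \<in> K \<and> y \<in> K} \<le> ((2 * DIM('a)) choose DIM('a)) * vol K"
proof -
  define n where "n = DIM('a)"
  have n: "n \<ge> 1" using DIM_positive[where 'a='a] by (simp add: n_def)
  define D where "D = {x - y | x y. x \<in> K \<and> y \<in> K}"
  have cD: "compact D" unfolding D_def using K(1) K(1) by (rule compact_differences)
  \<comment> \<open>The graph of the slices, \<open>(x, s) \<in> W\<close> if and only if \<open>x \<in> (1 - s) D\<close>; compactness makes it measurable.\<close>
  define W where "W = (\<lambda>(d, s::real). ((1 - s) *\<^sub>R d, s)) ` (D \<times> {0..1})"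
  have "compact W" unfolding W_def using cD
    by (intro compact_continuous_image compact_Times) (auto simp: case_prod_unfold intro!: continuous_intros)
  then have W[measurable]: "W \<in> sets (borel \<Otimes>\<^sub>M borel)"
    unfolding borel_prod by (rule borel_compact)
  have [measurable]: "(\<lambda>x. indicator W x :: ennreal) \<in> borel_measurable (borel \<Otimes>\<^sub>M borel)"
    using W by (rule borel_measurable_indicator)
  define g where "g x s = ennreal (n * s ^ (n - 1) * vol K) * indicator W (x, s)" for x :: 'a and s :: real
  have g_meas: "case_prod g \<in> borel_measurable (lborel \<Otimes>\<^sub>M lborel)"
    unfolding g_def by measurable
  have W_iff: "(x, s) \<in> W \<longleftrightarrow> 0 \<le> s \<and> s \<le> 1 \<and> x \<in> (*\<^sub>R) (1 - s) ` D" for x s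
    by (auto simp: W_def)
  have inner_s: "(\<integral>\<^sup>+s. g x s \<partial>lborel) \<le> emeasure lborel (K \<inter> (+) x ` K)" for x
  proof -
    define v where "v = vol (K \<inter> (+) x ` K)"
    \<comment> \<open>The largest height at which the lower bound allows \<open>x\<close> to be in a slice.\<close>
    define u where "u = root n (v / vol K)"
    have u: "0 \<le> u" "u ^ n = v / vol K"
      using n K(3) by (auto simp: u_def v_def real_root_pow_pos2)
    have le_u: "s \<le> u" "0 \<le> s" if xs: "(x, s) \<in> W" for s
    proof -
      have s: "0 \<le> s" "s \<le> 1" using xs by (auto simp: W_iff)
      obtain d where "d \<in> D" "x = (1 - s) *\<^sub>R d" using xs by (auto simp: W_iff)
      then obtain a b where "a \<in> K" "b \<in> K" "x = (1 - s) *\<^sub>R (a - b)"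
        by (auto simp: D_def)
      then have "s ^ n * vol K \<le> v"
        using Int_translate_ge_along_difference_body[OF K(1,2) s] by (simp add: v_def n_def)
      then have "s ^ n \<le> u ^ n" using K(3) by (simp add: u(2) field_simps)
      then show "s \<le> u" using u(1) n power_mono_iff[OF s(1) u(1), of n] by simp
      show "0 \<le> s" by fact
    qed
    have "(\<integral>\<^sup>+s. g x s \<partial>lborel)
        \<le> (\<integral>\<^sup>+s. ennreal (n * s ^ (n - 1) * vol K) * indicator {0..u} s \<partial>lborel)"
      unfolding g_def using le_u by (intro nn_integral_mono mult_left_mono) (auto simp: indicator_def)
    also have "\<dots> = ennreal (u ^ n * vol K - 0 ^ n * vol K)"
      by (rule nn_integral_FTC_Icc[where F = "\<lambda>s. s ^ n * vol K"])
        (use u K(3) in \<open>auto intro!: derivative_eq_intros\<close>)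
    also have "\<dots> = ennreal v" using n u(2) K(3) by (simp add: zero_power)
    also have "\<dots> = emeasure lborel (K \<inter> (+) x ` K)"
      unfolding v_def using K(1)
      by (intro emeasure_lborel_compact[symmetric] compact_Int compact_translation)
    finally show ?thesis .
  qed
  have inner_x: "(\<integral>\<^sup>+x. g x s \<partial>lborel) =
      ennreal (vol K * vol D) * (ennreal (n * s ^ (n - 1) * (1 - s) ^ n) * indicator {0..1} s)" for s :: real
  proof (cases "s \<in> {0..1}")
    case True
    have cs: "compact ((*\<^sub>R) (1 - s) ` D)" using cD by (rule compact_scaling)
    have "(\<integral>\<^sup>+x. g x s \<partial>lborel) =
        (\<integral>\<^sup>+x. ennreal (n * s ^ (n - 1) * vol K) * indicator ((*\<^sub>R) (1 - s) ` D) x \<partial>lborel)"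
      unfolding g_def using True by (intro nn_integral_cong) (auto simp: indicator_def W_iff)
    also have "\<dots> = ennreal (n * s ^ (n - 1) * vol K) * ennreal ((1 - s) ^ n * vol D)"
      using cs True
      by (simp add: nn_integral_cmult_indicator borel_compact emeasure_lborel_compact
          vol_scaleR_image n_def)
    also have "\<dots> = ennreal (vol K * vol D) * ennreal (n * s ^ (n - 1) * (1 - s) ^ n)"
      using True by (simp add: ennreal_mult'[symmetric] ac_simps)
    finally show ?thesis using True by simp
  next
    case False
    then have "g x s = 0" for x by (auto simp: g_def W_iff indicator_def)
    then show ?thesis using False by simp
  qed
  have "ennreal (vol K * vol D * (1 / ((2 * n) choose n))) =
      ennreal (vol K * vol D) *
      (\<integral>\<^sup>+s. ennreal (n * s ^ (n - 1) * (1 - s) ^ n) * indicator {0..1} s \<partial>lborel)"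
    unfolding nn_integral_Beta_binomial[OF n] by (rule ennreal_mult') simp
  also have "\<dots> = (\<integral>\<^sup>+s. (\<integral>\<^sup>+x. g x s \<partial>lborel) \<partial>lborel)"
    unfolding inner_x by (subst nn_integral_cmult) auto
  also have "\<dots> = (\<integral>\<^sup>+x. (\<integral>\<^sup>+s. g x s \<partial>lborel) \<partial>lborel)"
    by (rule lborel_pair.Fubini') (rule g_meas)
  also have "\<dots> \<le> (\<integral>\<^sup>+x. emeasure lborel (K \<inter> (+) x ` K) \<partial>lborel)"
    by (intro nn_integral_mono inner_s)
  also have "\<dots> = ennreal (vol K * vol K)"
    by (rule nn_integral_emeasure_Int_translate[OF K(1) K(1)])
  finally have "vol K * vol D * (1 / ((2 * n) choose n)) \<le> vol K * vol K"
    using K(3) by (simp add: ennreal_le_iff)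
  then have "vol D * (1 / ((2 * n) choose n)) \<le> vol K"
    using K(3) by (simp only: mult.assoc mult_le_cancel_left_pos)
  moreover have "real ((2 * n) choose n) > 0" by simp
  ultimately show ?thesis
    unfolding D_def[symmetric] n_def[symmetric] by (simp add: field_simps)
qed

section \<open>Transversal and independence numbers of homothets\<close>

lemma two_minus_eq_iterated_difference:
  fixes K :: "'a::real_vector set"
  assumes "convex K"
  shows "two_minus K = {a - b | a b. a \<in> {x - y | x y. x \<in> K \<and> y \<in> K} \<and> b \<in> uminus ` K}"
    (is "_ = ?R")
proof
  show "two_minus K \<subseteq> ?R"
  proof
    fix w assume "w \<in> two_minus K"
    then obtain x y where "x \<in> K" "y \<in> K" "w = 2 *\<^sub>R x - y" by (auto simp: two_minus_def)
    then show "w \<in> ?R"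
      by (intro CollectI exI[of _ "x - y"] exI[of _ "- x"]) (auto simp: scaleR_2)
  qed
  show "?R \<subseteq> two_minus K"
  proof
    fix w assume "w \<in> ?R"
    then obtain x y z where w: "x \<in> K" "y \<in> K" "z \<in> K" "w = x - y + z" by auto
    have "(1/2) *\<^sub>R x + (1/2) *\<^sub>R z \<in> K" using w assms by (intro convexD) auto
    moreover have "w = 2 *\<^sub>R ((1/2) *\<^sub>R x + (1/2) *\<^sub>R z) - y"
      by (simp add: w(4) algebra_simps)
    ultimately show "w \<in> two_minus K" using w(2) by (auto simp: two_minus_def)
  qed
qed

lemma compact_two_minus:
  fixes K :: "'a::real_normed_vector set"
  assumes "compact K"
  shows "compact (two_minus K)"
proof -
  have "two_minus K = {x - y | x y. x \<in> (*\<^sub>R) 2 ` K \<and> y \<in> K}"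
    by (auto simp: two_minus_def)
  then show ?thesis
    using compact_differences[OF compact_scaling[OF assms] assms] by simp
qed

lemma vol_two_minus_ge:
  fixes K :: "'a::euclidean_space set"
  assumes "compact K" "K \<noteq> {}"
  shows "2 ^ DIM('a) * vol K \<le> vol (two_minus K)"
proof -
  obtain y where y: "y \<in> K" using assms(2) by blast
  have "2 ^ DIM('a) * vol K = vol ((\<lambda>x. 2 *\<^sub>R x + (- y)) ` K)"
    by (simp add: vol_affine_image del: add_uminus_conv_diff)
  also have "\<dots> \<le> vol (two_minus K)"
    using assms(1) y
    by (intro vol_mono_compact compact_two_minus compact_continuous_image continuous_intros)
      (auto simp: two_minus_def)
  finally show ?thesis .
qed

lemma vol_two_minus_symmetric:
  fixes K :: "'a::euclidean_space set"
  assumes "convex K" "K = uminus ` K"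
  shows "vol (two_minus K) = 3 ^ DIM('a) * vol K"
proof -
  have neg: "- y \<in> K" if "y \<in> K" for y using that assms(2) by blast
  have "two_minus K = (*\<^sub>R) 3 ` K"
  proof
    show "two_minus K \<subseteq> (*\<^sub>R) 3 ` K"
    proof
      fix w assume "w \<in> two_minus K"
      then obtain x y where w: "x \<in> K" "y \<in> K" "w = 2 *\<^sub>R x - y" by (auto simp: two_minus_def)
      have "(2/3) *\<^sub>R x + (1/3) *\<^sub>R (- y) \<in> K" using w neg assms(1) by (intro convexD) auto
      moreover have "w = 3 *\<^sub>R ((2/3) *\<^sub>R x + (1/3) *\<^sub>R (- y))" by (simp add: w(3) algebra_simps)
      ultimately show "w \<in> (*\<^sub>R) 3 ` K" by blast
    qed
    show "(*\<^sub>R) 3 ` K \<subseteq> two_minus K"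
    proof
      fix w assume "w \<in> (*\<^sub>R) 3 ` K"
      then obtain x where x: "x \<in> K" "w = 3 *\<^sub>R x" by auto
      have "(3::real) *\<^sub>R x = (2 + 1) *\<^sub>R x" by simp
      then have "w = 2 *\<^sub>R x - (- x)" unfolding x(2) scaleR_left_distrib by simp
      then show "w \<in> two_minus K" using x(1) neg unfolding two_minus_def by blast
    qed
  qed
  then show ?thesis by (simp add: vol_scaleR_image)
qed

text \<open>
  For \<open>c \<in> K\<close>, \<open>2 x - y = 2 (x - (y + c) / 2) + c\<close> with \<open>(y + c) / 2 \<in> K\<close>.
\<close>

lemma vol_two_minus_le:
  fixes K :: "'a::euclidean_space set"
  assumes K: "compact K" "convex K" "vol K > 0"
  shows "vol (two_minus K) \<le> 2 ^ DIM('a) * ((2 * DIM('a)) choose DIM('a)) * vol K"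
proof -
  obtain c where c: "c \<in> K" using K(3) by fastforce
  define D where "D = {x - y | x y. x \<in> K \<and> y \<in> K}"
  have cD: "compact D" unfolding D_def using K(1) K(1) by (rule compact_differences)
  have "two_minus K \<subseteq> (\<lambda>d. 2 *\<^sub>R d + c) ` D"
  proof
    fix w assume "w \<in> two_minus K"
    then obtain x y where w: "x \<in> K" "y \<in> K" "w = 2 *\<^sub>R x - y" by (auto simp: two_minus_def)
    have "(1/2) *\<^sub>R y + (1/2) *\<^sub>R c \<in> K" using w c K(2) by (intro convexD) auto
    then have "x - ((1/2) *\<^sub>R y + (1/2) *\<^sub>R c) \<in> D" unfolding D_def using w(1) by blast
    moreover have "w = 2 *\<^sub>R (x - ((1/2) *\<^sub>R y + (1/2) *\<^sub>R c)) + c"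
      by (simp add: w(3) algebra_simps)
    ultimately show "w \<in> (\<lambda>d. 2 *\<^sub>R d + c) ` D" by blast
  qed
  then have "vol (two_minus K) \<le> vol ((\<lambda>d. 2 *\<^sub>R d + c) ` D)"
    using K(1) cD
    by (intro vol_mono_compact compact_two_minus compact_continuous_image continuous_intros)
  also have "\<dots> = 2 ^ DIM('a) * vol D" by (simp add: vol_affine_image del: add_uminus_conv_diff)
  also have "\<dots> \<le> 2 ^ DIM('a) * (((2 * DIM('a)) choose DIM('a)) * vol K)"
    using rogers_shephard[OF K] by (intro mult_left_mono) (auto simp: D_def)
  finally show ?thesis by (simp add: mult.assoc)
qed

theorem theorem1:
  fixes K :: "(real ^ 'n) set" and \<F> :: "(real ^ 'n) set set" and n :: nat and c :: real
  defines "n \<equiv> CARD('n)"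
  defines "c \<equiv> real n * ln (real n) + real n * ln (ln (real n)) + 5 * real n"
  assumes "n \<ge> 2"
    and "convex_body K"
    and "\<And>F. F \<in> \<F> \<Longrightarrow> positive_homothet K F"
  shows "\<nu> \<F> \<le> \<tau> \<F>
    \<and> ereal_of_enat (\<tau> \<F>)
        \<le> ereal (vol (two_minus K) / vol K * c) * ereal_of_enat (\<nu> \<F>)
    \<and> ereal (vol (two_minus K) / vol K * c) * ereal_of_enat (\<nu> \<F>)
        \<le> (if K = uminus ` K
            then ereal (3 ^ n * c) * ereal_of_enat (\<nu> \<F>)
            else ereal (2 ^ n * real ((2 * n) choose n) * c) * ereal_of_enat (\<nu> \<F>))"
proof -
  have dim: "DIM(real ^ 'n) = n" by (simp add: n_def)
  have K: "compact K" "convex K" using \<open>convex_body K\<close> by (auto simp: convex_body_def)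
  have vK: "vol K > 0" using \<open>convex_body K\<close> by (rule convex_body_vol_pos)
  then have Kne: "K \<noteq> {}" by auto
  define q where "q = vol (two_minus K) / vol K"
  have "2 ^ n \<le> q"
    using vol_two_minus_ge[OF K(1) Kne, unfolded dim] vK by (simp add: q_def field_simps)
  moreover have "(2::real) ^ 2 \<le> 2 ^ n" using \<open>n \<ge> 2\<close> by (intro power_increasing) auto
  \<comment> \<open>This absorbs the rounding term \<open>1\<close> of the covering bound into \<open>q / 4\<close>.\<close>
  ultimately have q4: "q \<ge> 4" by simp
  obtain \<eta> where \<eta>: "0 < \<eta>" "\<eta> < 1" "1 \<le> 4 * (1 - \<eta>) / \<eta>"
      "(n * ln (4 * (1 - \<eta>) / \<eta>) + 1) / (1 - \<eta>) ^ n + 1/4 \<le> c"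
    using covering_constant_arithmetic[OF \<open>n \<ge> 2\<close>] unfolding c_def by blast
  have c0: "c > 0"
  proof -
    have "0 \<le> n * ln (4 * (1 - \<eta>) / \<eta>)" using \<eta>(3) by (intro mult_nonneg_nonneg) auto
    then have "0 \<le> (n * ln (4 * (1 - \<eta>) / \<eta>) + 1) / (1 - \<eta>) ^ n" using \<eta>(2) by simp
    then show ?thesis using \<eta>(4) by linarith
  qed
  define A where "A = {x - y | x y. x \<in> K \<and> y \<in> K}"
  have A: "compact A" "A \<noteq> {}"
    unfolding A_def using K(1) Kne by (auto intro: compact_differences)
  have B: "compact (uminus ` K)" "convex (uminus ` K)" "vol (uminus ` K) = vol K"
    using K vol_reflect[of 0 K] by (auto intro: compact_negations convex_negations)
  obtain P where P: "finite P" "\<forall>a\<in>A. \<exists>p\<in>P. a - p \<in> uminus ` K"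
    "card P \<le> (n * ln (4 * (1 - \<eta>) / \<eta>) + 1) * (q / (1 - \<eta>) ^ n) + 1"
    using covering_number_bound[OF A B(1,2) _ \<eta>(1-3)] vK
    unfolding A_def two_minus_eq_iterated_difference[OF K(2), symmetric] B(3) dim q_def by blast
  have pierce: "\<exists>p\<in>P. p - (x - y) \<in> K" if xy: "x \<in> K" "y \<in> K" for x y
  proof -
    have "x - y \<in> A" unfolding A_def using xy by blast
    then obtain p where "p \<in> P" "(x - y) - p \<in> uminus ` K" using P(2) by blast
    then show ?thesis using mem_reflect_iff[of "(x - y) - p" 0 K] by auto
  qed
  have "card P \<le> q * ((n * ln (4 * (1 - \<eta>) / \<eta>) + 1) / (1 - \<eta>) ^ n) + q * (1/4)"
    using P(3) q4 by (simp add: mult.commute)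
  also have "\<dots> \<le> q * c"
    using \<eta>(4) q4 by (simp only: distrib_left[symmetric]) (rule mult_left_mono, auto)
  finally have "card P \<le> q * c" .
  then have upper: "ereal_of_enat (\<tau> \<F>) \<le> ereal (q * c) * ereal_of_enat (\<nu> \<F>)"
    using transversal_number_homothets_le[OF K Kne P(1) pierce assms(5)] q4 c0 by simp
  have mono: "ereal (q * c) * ereal_of_enat (\<nu> \<F>) \<le> ereal (t * c) * ereal_of_enat (\<nu> \<F>)"
    if "q \<le> t" for t
    using that c0 by (intro ereal_mult_right_mono) (simp_all add: mult_right_mono)
  have "q \<le> 3 ^ n" if "K = uminus ` K"
    using vol_two_minus_symmetric[OF K(2) that, unfolded dim] vK by (simp add: q_def)
  moreover have "q \<le> 2 ^ n * real ((2 * n) choose n)"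
    using vol_two_minus_le[OF K vK, unfolded dim] vK by (simp add: q_def divide_le_eq)
  ultimately show ?thesis
    using independence_number_le_transversal_number upper mono
    unfolding q_def[symmetric] by simp
qed

end
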